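(* Let $(M,L)$ be a Finsler manifold and let $L\to\overline{L}=e^{\sigma}L+\beta$, $\beta=b_i(x)y^i$, be a $\beta$-conformal change. Consider the two assertions: (i) the covariant vector $b_i$ is parallel with respect to the Cartan connection of $(M,L)$, i.e. $b_{i|j}=0$; (ii) the difference tensor $D^i_{jk}=\overline{\Gamma}^i_{jk}-\Gamma^i_{jk}$ vanishes identically. Then: (a) if (i) and (ii) hold, then $\sigma$ is homothetic (i.e. $\partial_i\sigma=0$ for all $i$); (b) if $\sigma$ is homothetic, then (i) and (ii) are equivalent.
   Context: $M$ is an $n$-dimensional $C^\infty$ manifold, $L(x,y)$ a Finsler metric function; all objects are considered in local coordinates $(x^i,y^i)$ at $y\neq0$. A $\beta$-conformal change is $L\to\overline{L}=e^{\sigma}L+\beta$, with $\sigma$ a smooth function on $M$ and $\beta=b_i(x)y^i$ a 1-form on $M$; $\overline{L}$ is assumed to be a Finsler metric function too. $\partial_i=\partial/\partial x^i$, $\dot\partial_i=\partial/\partial y^i$; summation convention. Cartan connection of $(M,L)$: $g_{ij}=\frac12\dot\partial_i\dot\partial_jL^2$ with inverse $g^{ij}$; $N^i_j=\frac12\dot\partial_jS^i$ with $S^i=\frac12g^{ir}(y^k\partial_k\dot\partial_rL^2-\partial_rL^2)$, $\delta_k=\partial_k-N^r_k\dot\partial_r$, $\Gamma^i_{jk}=\frac12g^{ir}(\delta_jg_{rk}+\delta_kg_{rj}-\delta_rg_{jk})$. $\overline{\Gamma}^i_{jk}$ is the same object built from $\overline{L}$. The $h$-covariant derivative of $b_i$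 is $b_{i|j}=\delta_jb_i-b_r\Gamma^r_{ij}$. *)

theory Defs
  imports "HOL-Analysis.Analysis"
begin

text \<open>For open \<open>U\<close>: \<open>f\<close> is of class \<open>C\<^sup>k\<close> on \<open>U\<close>.\<close>

primrec Ck_on :: "nat \<Rightarrow> 'a::euclidean_space set \<Rightarrow> ('a \<Rightarrow> 'b::real_normed_vector) \<Rightarrow> bool" where
  "Ck_on 0 U f \<longleftrightarrow> continuous_on U f"
| "Ck_on (Suc k) U f \<longleftrightarrow>
     (\<forall>x\<in>U. f differentiable (at x)) \<and>
     (\<forall>e\<in>Basis. Ck_on k U (\<lambda>x. frechet_derivative f (at x) e))"

definition smooth_on :: "'a::euclidean_space set \<Rightarrow> ('a \<Rightarrow> 'b::real_normed_vector) \<Rightarrow> bool" where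
  "smooth_on U f \<longleftrightarrow> (\<forall>k. Ck_on k U f)"

text \<open>A chart is a pair of a domain and a coordinate map. The manifold is the whole type \<open>'m\<close>, its
  dimension is \<open>CARD('n)\<close>; the Hausdorff property and second countability are sort constraints.\<close>

type_synonym ('m, 'n) chart = "'m set \<times> ('m \<Rightarrow> real ^ 'n)"

definition smooth_atlas ::
    "('m::{t2_space, second_countable_topology}, 'n::finite) chart set \<Rightarrow> bool" where
  "smooth_atlas A \<longleftrightarrow>
     (\<Union>(U, \<phi>)\<in>A. U) = UNIV \<and>
     (\<forall>(U, \<phi>)\<in>A. open U \<and> open (\<phi> ` U) \<and> homeomorphism U (\<phi> ` U) \<phi> (inv_into U \<phi>)) \<and>
     (\<forall>(U, \<phi>)\<in>A. \<forall>(V, \<psi>)\<in>A. smooth_on (\<phi> ` (U \<inter> V)) (\<psi> \<circ> inv_into U \<phi>))"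

definition chart_image :: "('m, 'n::finite) chart \<Rightarrow> (real ^ 'n) set" where
  "chart_image c = snd c ` fst c"

definition chart_inv :: "('m, 'n::finite) chart \<Rightarrow> real ^ 'n \<Rightarrow> 'm" where
  "chart_inv c = inv_into (fst c) (snd c)"

definition smooth_fun_on ::
    "('m::topological_space, 'n::finite) chart set \<Rightarrow> 'm set \<Rightarrow> ('m \<Rightarrow> real) \<Rightarrow> bool" where
  "smooth_fun_on A W f \<longleftrightarrow> (\<forall>c\<in>A. smooth_on (snd c ` (fst c \<inter> W)) (f \<circ> chart_inv c))"

text \<open>Tangent vectors at \<open>p\<close> are derivations of the functions that are smooth near \<open>p\<close>;
  \<open>tangent_vec A c x y\<close> is the vector \<open>y\<^sup>i \<partial>/\<partial>x\<^sup>i\<close> at the point with coordinates \<open>x\<close> in the chart \<open>c\<close>.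
  It is set to 0 on functions that are not smooth near the point, so that the same vector
  expressed in two charts is the same object. Thus a function on the tangent bundle is given
  as a function of type \<open>'m \<Rightarrow> 'm tangent \<Rightarrow> real\<close>, of which only the values at tangent
  vectors are relevant.\<close>

type_synonym 'm tangent = "('m \<Rightarrow> real) \<Rightarrow> real"

definition tangent_vec ::
    "('m::topological_space, 'n::finite) chart set \<Rightarrow> ('m, 'n) chart \<Rightarrow> real ^ 'n \<Rightarrow> real ^ 'n \<Rightarrow> 'm tangent" where
  "tangent_vec A c x y = (\<lambda>f.
     if \<exists>W. open W \<and> chart_inv c x \<in> W \<and> smooth_fun_on A W f
     then frechet_derivative (f \<circ> chart_inv c) (at x) y else 0)"

definition in_coords ::
    "('m::topological_space, 'n::finite) chart set \<Rightarrow> ('m, 'n) chart \<Rightarrow> ('m \<Rightarrow> 'm tangent \<Rightarrow> real)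
      \<Rightarrow> real ^ 'n \<Rightarrow> real ^ 'n \<Rightarrow> real" where
  "in_coords A c F = (\<lambda>x y. F (chart_inv c x) (tangent_vec A c x y))"

definition one_form_coeff ::
    "('m::topological_space, 'n::finite) chart set \<Rightarrow> ('m, 'n) chart \<Rightarrow> ('m \<Rightarrow> 'm tangent \<Rightarrow> real)
      \<Rightarrow> real ^ 'n \<Rightarrow> real ^ 'n" where
  "one_form_coeff A c \<beta> x = (\<chi> i. in_coords A c \<beta> x (axis i 1))"

definition one_form ::
    "('m::topological_space, 'n::finite) chart set \<Rightarrow> ('m \<Rightarrow> 'm tangent \<Rightarrow> real) \<Rightarrow> bool" where
  "one_form A \<beta> \<longleftrightarrow> (\<forall>c\<in>A.
     (\<forall>x\<in>chart_image c. \<forall>y. in_coords A c \<beta> x y = (\<Sum>i\<in>UNIV. one_form_coeff A c \<beta> x $ i * y $ i)) \<and>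
     smooth_on (chart_image c) (one_form_coeff A c \<beta>))"

text \<open>Partial derivatives \<open>\<partial>\<^sub>i\<close> with respect to \<open>x\<^sup>i\<close>, and \<open>\<partial>/\<partial>y\<^sup>i\<close>.\<close>

definition pdx :: "'n::finite \<Rightarrow> (real ^ 'n \<Rightarrow> real ^ 'n \<Rightarrow> real) \<Rightarrow> real ^ 'n \<Rightarrow> real ^ 'n \<Rightarrow> real" where
  "pdx i F x y = frechet_derivative (\<lambda>z. F z y) (at x) (axis i 1)"

definition pdy :: "'n::finite \<Rightarrow> (real ^ 'n \<Rightarrow> real ^ 'n \<Rightarrow> real) \<Rightarrow> real ^ 'n \<Rightarrow> real ^ 'n \<Rightarrow> real" where
  "pdy i F x y = frechet_derivative (\<lambda>z. F x z) (at y) (axis i 1)"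

text \<open>The following objects are computed from the local expression \<open>L\<close> of a Finsler metric function.
  For those with an upper index, that index is the first argument.\<close>

definition sq :: "(real ^ 'n \<Rightarrow> real ^ 'n \<Rightarrow> real) \<Rightarrow> real ^ 'n \<Rightarrow> real ^ 'n \<Rightarrow> real" where
  "sq L = (\<lambda>x y. (L x y)\<^sup>2)"

definition metric ::
    "(real ^ 'n::finite \<Rightarrow> real ^ 'n \<Rightarrow> real) \<Rightarrow> 'n \<Rightarrow> 'n \<Rightarrow> real ^ 'n \<Rightarrow> real ^ 'n \<Rightarrow> real" where
  "metric L i j = (\<lambda>x y. 1/2 * pdy i (pdy j (sq L)) x y)"

definition metric_inv ::
    "(real ^ 'n::finite \<Rightarrow> real ^ 'n \<Rightarrow> real) \<Rightarrow> 'n \<Rightarrow> 'n \<Rightarrow> real ^ 'n \<Rightarrow> real ^ 'n \<Rightarrow> real" where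
  "metric_inv L i j = (\<lambda>x y. matrix_inv (\<chi> k l. metric L k l x y) $ i $ j)"

definition spray ::
    "(real ^ 'n::finite \<Rightarrow> real ^ 'n \<Rightarrow> real) \<Rightarrow> 'n \<Rightarrow> real ^ 'n \<Rightarrow> real ^ 'n \<Rightarrow> real" where
  "spray L i = (\<lambda>x y. 1/2 * (\<Sum>r\<in>UNIV. metric_inv L i r x y *
     ((\<Sum>k\<in>UNIV. y $ k * pdx k (pdy r (sq L)) x y) - pdx r (sq L) x y)))"

definition nonlin_conn ::
    "(real ^ 'n::finite \<Rightarrow> real ^ 'n \<Rightarrow> real) \<Rightarrow> 'n \<Rightarrow> 'n \<Rightarrow> real ^ 'n \<Rightarrow> real ^ 'n \<Rightarrow> real" where
  "nonlin_conn L i j = (\<lambda>x y. 1/2 * pdy j (spray L i) x y)"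

definition delta ::
    "(real ^ 'n::finite \<Rightarrow> real ^ 'n \<Rightarrow> real) \<Rightarrow> 'n \<Rightarrow> (real ^ 'n \<Rightarrow> real ^ 'n \<Rightarrow> real)
      \<Rightarrow> real ^ 'n \<Rightarrow> real ^ 'n \<Rightarrow> real" where
  "delta L k F = (\<lambda>x y. pdx k F x y - (\<Sum>r\<in>UNIV. nonlin_conn L r k x y * pdy r F x y))"

definition cartan ::
    "(real ^ 'n::finite \<Rightarrow> real ^ 'n \<Rightarrow> real) \<Rightarrow> 'n \<Rightarrow> 'n \<Rightarrow> 'n \<Rightarrow> real ^ 'n \<Rightarrow> real ^ 'n \<Rightarrow> real" where
  "cartan L i j k = (\<lambda>x y. 1/2 * (\<Sum>r\<in>UNIV. metric_inv L i r x y *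
     (delta L j (metric L r k) x y + delta L k (metric L r j) x y - delta L r (metric L j k) x y)))"

text \<open>The h-covariant derivative \<open>b\<^bsub>i|j\<^esub>\<close>.\<close>

definition hcov ::
    "(real ^ 'n::finite \<Rightarrow> real ^ 'n \<Rightarrow> real) \<Rightarrow> (real ^ 'n \<Rightarrow> real ^ 'n) \<Rightarrow> 'n \<Rightarrow> 'n
      \<Rightarrow> real ^ 'n \<Rightarrow> real ^ 'n \<Rightarrow> real" where
  "hcov L b i j = (\<lambda>x y. delta L j (\<lambda>x y. b x $ i) x y - (\<Sum>r\<in>UNIV. b x $ r * cartan L r i j x y))"

text \<open>Homogeneity forces \<open>L\<close> to vanish on the zero section.\<close>

definition finsler_metric ::
    "('m::topological_space, 'n::finite) chart set \<Rightarrow> ('m \<Rightarrow> 'm tangent \<Rightarrow> real) \<Rightarrow> bool" where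
  "finsler_metric A F \<longleftrightarrow> (\<forall>c\<in>A. let L = in_coords A c F; V = chart_image c in
     smooth_on (V \<times> (- {0})) (\<lambda>(x, y). L x y) \<and>
     (\<forall>x\<in>V. \<forall>y. y \<noteq> 0 \<longrightarrow> L x y > 0) \<and>
     (\<forall>x\<in>V. \<forall>y. \<forall>t>0. L x (t *\<^sub>R y) = t * L x y) \<and>
     (\<forall>x\<in>V. \<forall>y. y \<noteq> 0 \<longrightarrow>
        (\<forall>v. v \<noteq> 0 \<longrightarrow> (\<Sum>i\<in>UNIV. \<Sum>j\<in>UNIV. metric L i j x y * v $ i * v $ j) > 0)))"

definition beta_conformal ::
    "('m \<Rightarrow> real) \<Rightarrow> ('m \<Rightarrow> 'm tangent \<Rightarrow> real) \<Rightarrow> ('m \<Rightarrow> 'm tangent \<Rightarrow> real) \<Rightarrow> 'm \<Rightarrow> 'm tangent \<Rightarrow> real" where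
  "beta_conformal \<sigma> \<beta> L = (\<lambda>p v. exp (\<sigma> p) * L p v + \<beta> p v)"

definition homothetic ::
    "('m::topological_space, 'n::finite) chart set \<Rightarrow> ('m \<Rightarrow> real) \<Rightarrow> bool" where
  "homothetic A \<sigma> \<longleftrightarrow> (\<forall>c\<in>A. \<forall>x\<in>chart_image c. \<forall>i.
     frechet_derivative (\<sigma> \<circ> chart_inv c) (at x) (axis i 1) = 0)"

definition cartan_parallel ::
    "('m::topological_space, 'n::finite) chart set \<Rightarrow> ('m \<Rightarrow> 'm tangent \<Rightarrow> real)
      \<Rightarrow> ('m \<Rightarrow> 'm tangent \<Rightarrow> real) \<Rightarrow> bool" where
  "cartan_parallel A L \<beta> \<longleftrightarrow> (\<forall>c\<in>A. \<forall>x\<in>chart_image c. \<forall>y. y \<noteq> 0 \<longrightarrow>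
     (\<forall>i j. hcov (in_coords A c L) (one_form_coeff A c \<beta>) i j x y = 0))"

definition difference_tensor ::
    "('m::topological_space, 'n::finite) chart set \<Rightarrow> ('m, 'n) chart \<Rightarrow> ('m \<Rightarrow> 'm tangent \<Rightarrow> real)
      \<Rightarrow> ('m \<Rightarrow> 'm tangent \<Rightarrow> real) \<Rightarrow> 'n \<Rightarrow> 'n \<Rightarrow> 'n \<Rightarrow> real ^ 'n \<Rightarrow> real ^ 'n \<Rightarrow> real" where
  "difference_tensor A c L L' i j k = (\<lambda>x y.
     cartan (in_coords A c L') i j k x y - cartan (in_coords A c L) i j k x y)"

definition difference_vanishes ::
    "('m::topological_space, 'n::finite) chart set \<Rightarrow> ('m \<Rightarrow> 'm tangent \<Rightarrow> real)
      \<Rightarrow> ('m \<Rightarrow> 'm tangent \<Rightarrow> real) \<Rightarrow> bool" where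
  "difference_vanishes A L L' \<longleftrightarrow> (\<forall>c\<in>A. \<forall>x\<in>chart_image c. \<forall>y. y \<noteq> 0 \<longrightarrow>
     (\<forall>i j k. difference_tensor A c L L' i j k x y = 0))"

end

theory Submission
  imports Defs
begin

text \<open>Write \<open>l\<^sub>i = \<partial>L/\<partial>y\<^sup>i\<close>. The Cartan connection satisfies \<open>\<delta>\<^sub>k L = 0\<close>, \<open>\<delta>\<^sub>k l\<^sub>i = \<Gamma>\<^sup>r\<^sub>i\<^sub>k l\<^sub>r\<close> and
  \<open>y\<^sup>j \<Gamma>\<^sup>i\<^sub>j\<^sub>k = N\<^sup>i\<^sub>k\<close>, while \<open>L' = e\<^sup>\<sigma> L + \<beta>\<close> has \<open>l'\<^sub>i = e\<^sup>\<sigma> l\<^sub>i + b\<^sub>i\<close>. If \<open>\<Gamma>' = \<Gamma>\<close>, then \<open>N' = N\<close> and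
  \<open>\<delta>' = \<delta>\<close>, and subtracting the equations for \<open>l\<close> and \<open>l'\<close> gives
  \<open>e\<^sup>\<sigma> \<partial>\<^sub>k\<sigma> l\<^sub>i + b\<^bsub>i|k\<^esub> = 0\<close>. This yields (a), since \<open>y\<^sup>i l\<^sub>i = L > 0\<close>, and (ii) \<open>\<Longrightarrow>\<close> (i) in (b).
  Conversely, if \<open>\<partial>\<sigma> = 0\<close> and \<open>b\<^bsub>i|k\<^esub> = 0\<close>, then \<open>\<delta>\<^sub>k L' = 0\<close> and \<open>\<delta>\<^sub>k l'\<^sub>i = \<Gamma>\<^sup>r\<^sub>i\<^sub>k l'\<^sub>r\<close>; contracting with
  \<open>y\<^sup>k\<close> shows that \<open>L\<close> and \<open>L'\<close> have the same spray, hence the same \<open>N\<close>, and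
  \<open>g'\<^sub>i\<^sub>j = l'\<^sub>i l'\<^sub>j + L' e\<^sup>\<sigma> \<partial>l\<^sub>i/\<partial>y\<^sup>j\<close> is compatible with the symmetric \<open>\<Gamma>\<close>, which determines \<open>\<Gamma>'\<close>.\<close>

section \<open>Smooth functions and mixed derivatives\<close>

text \<open>Two applications of the mean value theorem: first to \<open>a\<close>, the increment of
  \<open>f\<close> over \<open>h *\<^sub>R v\<close> as a function of the position along
  \<open>u\<close>; then to the derivative of \<open>f\<close> along \<open>u\<close>, on a segment
  in direction \<open>v\<close>.\<close>

lemma difference_quotient_mixed_derivative:
  fixes f :: "'a::euclidean_space \<Rightarrow> real"
  assumes h: "h > 0"
    and seg: "\<And>s t. 0 \<le> s \<Longrightarrow> s \<le> h \<Longrightarrow> 0 \<le> t \<Longrightarrow> t \<le> h \<Longrightarrow> p + s *\<^sub>R u + t *\<^sub>R v \<in> S"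
    and f: "\<And>q. q \<in> S \<Longrightarrow> f differentiable (at q)"
    and fu: "\<And>q. q \<in> S \<Longrightarrow> (\<lambda>q. frechet_derivative f (at q) u) differentiable (at q)"
  shows "\<exists>s t. 0 \<le> s \<and> s \<le> h \<and> 0 \<le> t \<and> t \<le> h \<and>
    f (p + h *\<^sub>R u + h *\<^sub>R v) - f (p + h *\<^sub>R u) - f (p + h *\<^sub>R v) + f p =
    h * h * frechet_derivative (\<lambda>q. frechet_derivative f (at q) u) (at (p + s *\<^sub>R u + t *\<^sub>R v)) v"
proof -
  let ?fu = "\<lambda>q. frechet_derivative f (at q) u"
  define a where "a s = f (p + s *\<^sub>R u + h *\<^sub>R v) - f (p + s *\<^sub>R u)" for s
  have df: "((\<lambda>s. f (p + s *\<^sub>R u + t *\<^sub>R v)) has_real_derivative ?fu (p + s *\<^sub>R u + t *\<^sub>R v)) (at s)"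
    if "0 \<le> s" "s \<le> h" "0 \<le> t" "t \<le> h" for s t
  proof -
    have "(f has_derivative frechet_derivative f (at (p + s *\<^sub>R u + t *\<^sub>R v))) (at (p + s *\<^sub>R u + t *\<^sub>R v))"
      using f[OF seg[OF that]] frechet_derivative_works by blast
    then have "((\<lambda>s. f (p + s *\<^sub>R u + t *\<^sub>R v)) has_derivative
        (\<lambda>d. frechet_derivative f (at (p + s *\<^sub>R u + t *\<^sub>R v)) (d *\<^sub>R u))) (at s)"
      by (rule has_derivative_compose[rotated]) (auto intro!: derivative_eq_intros)
    then show ?thesis
      unfolding has_field_derivative_def
      using linear_scale[OF linear_frechet_derivative[OF f[OF seg[OF that]]]] by (simp add: mult_commute_abs)
  qed
  have dfu: "((\<lambda>t. ?fu (p + s *\<^sub>R u + t *\<^sub>R v)) has_real_derivative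
      frechet_derivative ?fu (at (p + s *\<^sub>R u + t *\<^sub>R v)) v) (at t)"
    if "0 \<le> s" "s \<le> h" "0 \<le> t" "t \<le> h" for s t
  proof -
    have "(?fu has_derivative frechet_derivative ?fu (at (p + s *\<^sub>R u + t *\<^sub>R v))) (at (p + s *\<^sub>R u + t *\<^sub>R v))"
      using fu[OF seg[OF that]] frechet_derivative_works by blast
    then have "((\<lambda>t. ?fu (p + s *\<^sub>R u + t *\<^sub>R v)) has_derivative
        (\<lambda>d. frechet_derivative ?fu (at (p + s *\<^sub>R u + t *\<^sub>R v)) (d *\<^sub>R v))) (at t)"
      by (rule has_derivative_compose[rotated]) (auto intro!: derivative_eq_intros)
    then show ?thesis
      unfolding has_field_derivative_def
      using linear_scale[OF linear_frechet_derivative[OF fu[OF seg[OF that]]]] by (simp add: mult_commute_abs)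
  qed
  have da: "(a has_real_derivative (?fu (p + s *\<^sub>R u + h *\<^sub>R v) - ?fu (p + s *\<^sub>R u))) (at s)"
    if "0 \<le> s" "s \<le> h" for s
    unfolding a_def using df[OF that, of h] df[OF that, of 0] h by (auto intro!: DERIV_diff)
  obtain s where s: "0 < s" "s < h" "a h - a 0 = (h - 0) * (?fu (p + s *\<^sub>R u + h *\<^sub>R v) - ?fu (p + s *\<^sub>R u))"
    using MVT2[OF h da] by blast
  obtain t where t: "0 < t" "t < h" "?fu (p + s *\<^sub>R u + h *\<^sub>R v) - ?fu (p + s *\<^sub>R u + 0 *\<^sub>R v) =
      (h - 0) * frechet_derivative ?fu (at (p + s *\<^sub>R u + t *\<^sub>R v)) v"
    using MVT2[OF h dfu[of s]] s by auto
  have "f (p + h *\<^sub>R u + h *\<^sub>R v) - f (p + h *\<^sub>R u) - f (p + h *\<^sub>R v) + f p = a h - a 0"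
    by (simp add: a_def)
  with s t show ?thesis
    by (intro exI[of _ s] exI[of _ t]) simp
qed

text \<open>Schwarz's theorem. The second difference over a parallelogram is symmetric in
  \<open>u\<close> and \<open>v\<close>, so divided by \<open>h * h\<close> it is a value near
  \<open>p\<close> of either mixed derivative; continuity lets the parallelogram shrink to
  \<open>p\<close>.\<close>

lemma mixed_derivatives_commute:
  fixes f :: "'a::euclidean_space \<Rightarrow> real"
  assumes S: "open S" "p \<in> S"
    and f: "\<And>q. q \<in> S \<Longrightarrow> f differentiable (at q)"
    and fu: "\<And>q. q \<in> S \<Longrightarrow> (\<lambda>q. frechet_derivative f (at q) u) differentiable (at q)"
    and fv: "\<And>q. q \<in> S \<Longrightarrow> (\<lambda>q. frechet_derivative f (at q) v) differentiable (at q)"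
    and fuv: "continuous_on S (\<lambda>q. frechet_derivative (\<lambda>q. frechet_derivative f (at q) u) (at q) v)"
    and fvu: "continuous_on S (\<lambda>q. frechet_derivative (\<lambda>q. frechet_derivative f (at q) v) (at q) u)"
  shows "frechet_derivative (\<lambda>q. frechet_derivative f (at q) u) (at p) v =
    frechet_derivative (\<lambda>q. frechet_derivative f (at q) v) (at p) u"
proof -
  define F where "F q = frechet_derivative (\<lambda>q. frechet_derivative f (at q) u) (at q) v" for q
  define G where "G q = frechet_derivative (\<lambda>q. frechet_derivative f (at q) v) (at q) u" for q
  have cont: "isCont F p" "isCont G p"
    using fuv fvu S by (auto simp: F_def[abs_def] G_def[abs_def] continuous_on_eq_continuous_at)
  have "\<bar>F p - G p\<bar> < e" if e: "e > 0" for e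
  proof -
    obtain d1 where d1: "d1 > 0" "\<And>q. dist q p < d1 \<Longrightarrow> \<bar>F q - F p\<bar> < e / 2"
      using cont(1) e unfolding continuous_at_eps_delta dist_real_def by (meson half_gt_zero)
    obtain d2 where d2: "d2 > 0" "\<And>q. dist q p < d2 \<Longrightarrow> \<bar>G q - G p\<bar> < e / 2"
      using cont(2) e unfolding continuous_at_eps_delta dist_real_def by (meson half_gt_zero)
    obtain d3 where d3: "d3 > 0" "\<And>q. dist q p < d3 \<Longrightarrow> q \<in> S"
      using S by (meson open_dist)
    define d where "d = min d1 (min d2 d3)"
    \<comment> \<open>The parallelogram with sides \<open>h *\<^sub>R u\<close> and
      \<open>h *\<^sub>R v\<close> stays within distance \<open>d\<close> of \<open>p\<close>; the
      summand 1 keeps the denominator positive when \<open>u\<close> and \<open>v\<close> are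
      zero.\<close>
    define h where "h = d / (2 * (norm u + norm v + 1))"
    have d: "d > 0" using d1 d2 d3 by (simp add: d_def)
    have n: "norm u + norm v + 1 > 0" by (meson add_nonneg_pos add_nonneg_nonneg norm_ge_zero zero_less_one)
    have h: "h > 0" using d n by (simp add: h_def)
    have small: "dist (p + s *\<^sub>R u + t *\<^sub>R v) p < d" if "0 \<le> s" "s \<le> h" "0 \<le> t" "t \<le> h" for s t
    proof -
      have "dist (p + s *\<^sub>R u + t *\<^sub>R v) p = norm (s *\<^sub>R u + t *\<^sub>R v)"
        by (simp add: dist_norm algebra_simps)
      also have "\<dots> \<le> s * norm u + t * norm v"
        using that by (intro order_trans[OF norm_triangle_ineq]) simp
      also have "\<dots> \<le> h * norm u + h * norm v"
        using that by (intro add_mono mult_right_mono) auto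
      also have "\<dots> < h * (2 * (norm u + norm v + 1))"
        using h by (auto simp: algebra_simps intro!: add_nonneg_pos)
      also have "\<dots> = d" using n by (simp add: h_def)
      finally show ?thesis .
    qed
    have small': "dist (p + t *\<^sub>R v + s *\<^sub>R u) p < d" if "0 \<le> s" "s \<le> h" "0 \<le> t" "t \<le> h" for s t
      using small[OF that] by (simp add: add_ac)
    have inS: "p + s *\<^sub>R u + t *\<^sub>R v \<in> S" "p + t *\<^sub>R v + s *\<^sub>R u \<in> S" if "0 \<le> s" "s \<le> h" "0 \<le> t" "t \<le> h" for s t
      using small[OF that] small'[OF that] d3 by (auto simp: d_def)
    obtain s t where st: "0 \<le> s" "s \<le> h" "0 \<le> t" "t \<le> h"
      "f (p + h *\<^sub>R u + h *\<^sub>R v) - f (p + h *\<^sub>R u) - f (p + h *\<^sub>R v) + f p = h * h * F (p + s *\<^sub>R u + t *\<^sub>R v)"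
      using difference_quotient_mixed_derivative[OF h inS(1) f fu] unfolding F_def by blast
    obtain s' t' where st': "0 \<le> s'" "s' \<le> h" "0 \<le> t'" "t' \<le> h"
      "f (p + h *\<^sub>R v + h *\<^sub>R u) - f (p + h *\<^sub>R v) - f (p + h *\<^sub>R u) + f p = h * h * G (p + s' *\<^sub>R v + t' *\<^sub>R u)"
      using difference_quotient_mixed_derivative[OF h inS(2) f fv] unfolding G_def by blast
    have "h * h * F (p + s *\<^sub>R u + t *\<^sub>R v) = h * h * G (p + s' *\<^sub>R v + t' *\<^sub>R u)"
      unfolding st(5)[symmetric] st'(5)[symmetric] by (simp add: add.assoc add.commute[of "h *\<^sub>R u"])
    then have "F (p + s *\<^sub>R u + t *\<^sub>R v) = G (p + s' *\<^sub>R v + t' *\<^sub>R u)"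
      using h by simp
    moreover have "\<bar>F (p + s *\<^sub>R u + t *\<^sub>R v) - F p\<bar> < e / 2"
      using small[OF st(1-4)] d1 by (simp add: d_def)
    moreover have "\<bar>G (p + s' *\<^sub>R v + t' *\<^sub>R u) - G p\<bar> < e / 2"
      using small'[OF st'(3,4,1,2)] d2 by (simp add: d_def)
    ultimately show ?thesis by linarith
  qed
  then have "F p - G p = 0" by (metis abs_0_eq less_irrefl zero_less_abs_iff)
  then show ?thesis by (simp add: F_def G_def)
qed

section \<open>Closure properties of the classes C^k\<close>

lemma Ck_on_cong:
  assumes "open U" "\<And>x. x \<in> U \<Longrightarrow> f x = g x" "Ck_on k U f"
  shows "Ck_on k U g"
  using assms(2,3)
proof (induction k arbitrary: f g)
  case 0
  then show ?case using continuous_on_cong by force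
next
  case (Suc k)
  have d: "(g has_derivative frechet_derivative f (at x)) (at x)" if "x \<in> U" for x
    using Suc.prems that
    by (auto intro: has_derivative_transform_within_open[OF _ assms(1)] simp: frechet_derivative_works)
  then have e: "frechet_derivative f (at x) = frechet_derivative g (at x)" if "x \<in> U" for x
    using that frechet_derivative_at by blast
  have "Ck_on k U (\<lambda>x. frechet_derivative g (at x) e)" if "e \<in> Basis" for e
    using Suc.IH[of "\<lambda>x. frechet_derivative f (at x) e" "\<lambda>x. frechet_derivative g (at x) e"] Suc.prems that e
    by simp
  then show ?case using d by (auto simp: differentiable_def)
qed

lemma Ck_on_Suc_imp: "Ck_on (Suc k) U f \<Longrightarrow> Ck_on k U f"
proof (induction k arbitrary: f)
  case 0
  then show ?case
    by (auto intro!: continuous_at_imp_continuous_on differentiable_imp_continuous_within)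
next
  case (Suc k)
  then show ?case by (metis Ck_on.simps(2))
qed

lemma Ck_on_add:
  assumes "open U" "Ck_on k U f" "Ck_on k U g"
  shows "Ck_on k U (\<lambda>x. f x + g x)"
  using assms(2,3)
proof (induction k arbitrary: f g)
  case 0
  then show ?case by (auto intro: continuous_on_add)
next
  case (Suc k)
  have "Ck_on k U (\<lambda>x. frechet_derivative (\<lambda>x. f x + g x) (at x) e)" if "e \<in> Basis" for e
  proof (rule Ck_on_cong[OF assms(1)])
    show "Ck_on k U (\<lambda>x. frechet_derivative f (at x) e + frechet_derivative g (at x) e)"
      using Suc that by simp
    show "frechet_derivative f (at x) e + frechet_derivative g (at x) e = frechet_derivative (\<lambda>x. f x + g x) (at x) e"
      if "x \<in> U" for x
    proof -
      have "((\<lambda>x. f x + g x) has_derivative (\<lambda>e. frechet_derivative f (at x) e + frechet_derivative g (at x) e)) (at x)"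
        using Suc.prems that by (intro has_derivative_add) (auto simp: frechet_derivative_works)
      from fun_cong[OF frechet_derivative_at[OF this], of e] show ?thesis by simp
    qed
  qed
  then show ?case using Suc.prems by simp
qed

text \<open>The product rule gives products with one differentiated factor; the undifferentiated one
  enters the induction through \<open>Ck_on_Suc_imp\<close>. The rule is available only at points of
  \<open>U\<close>, hence the detour through \<open>Ck_on_cong\<close>.\<close>

lemma Ck_on_mult:
  fixes f g :: "'a::euclidean_space \<Rightarrow> real"
  assumes "open U" "Ck_on k U f" "Ck_on k U g"
  shows "Ck_on k U (\<lambda>x. f x * g x)"
  using assms(2,3)
proof (induction k arbitrary: f g)
  case 0
  then show ?case by (auto intro: continuous_on_mult)
next
  case (Suc k)
  have "Ck_on k U (\<lambda>x. frechet_derivative (\<lambda>x. f x * g x) (at x) e)" if "e \<in> Basis" for e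
  proof (rule Ck_on_cong[OF assms(1)])
    show "Ck_on k U (\<lambda>x. f x * frechet_derivative g (at x) e + frechet_derivative f (at x) e * g x)"
      using Suc.prems[THEN Ck_on_Suc_imp] Suc.prems that by (intro Ck_on_add assms(1) Suc.IH) auto
    show "f x * frechet_derivative g (at x) e + frechet_derivative f (at x) e * g x = frechet_derivative (\<lambda>x. f x * g x) (at x) e"
      if "x \<in> U" for x
    proof -
      have "((\<lambda>x. f x * g x) has_derivative (\<lambda>e. f x * frechet_derivative g (at x) e + frechet_derivative f (at x) e * g x)) (at x)"
        using Suc.prems that by (intro has_derivative_mult) (auto simp: frechet_derivative_works)
      from fun_cong[OF frechet_derivative_at[OF this], of e] show ?thesis by simp
    qed
  qed
  then show ?case using Suc.prems by simp
qed

lemma smooth_on_mult: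
  fixes f g :: "'a::euclidean_space \<Rightarrow> real"
  shows "open U \<Longrightarrow> smooth_on U f \<Longrightarrow> smooth_on U g \<Longrightarrow> smooth_on U (\<lambda>x. f x * g x)"
  by (simp add: smooth_on_def Ck_on_mult)

lemma smooth_on_cong:
  "open U \<Longrightarrow> smooth_on U f \<Longrightarrow> (\<And>x. x \<in> U \<Longrightarrow> f x = g x) \<Longrightarrow> smooth_on U g"
  unfolding smooth_on_def using Ck_on_cong by blast

lemma smooth_on_imp_differentiable: "smooth_on U f \<Longrightarrow> x \<in> U \<Longrightarrow> f differentiable (at x)"
  unfolding smooth_on_def by (metis Ck_on.simps(2))

lemma smooth_on_imp_continuous_on: "smooth_on U f \<Longrightarrow> continuous_on U f"
  unfolding smooth_on_def by (metis Ck_on.simps(1))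

lemma smooth_on_derivative:
  "smooth_on U f \<Longrightarrow> e \<in> Basis \<Longrightarrow> smooth_on U (\<lambda>x. frechet_derivative f (at x) e)"
  unfolding smooth_on_def by (metis Ck_on.simps(2))

lemma smooth_on_mixed_derivatives_commute:
  fixes f :: "'a::euclidean_space \<Rightarrow> real"
  assumes "open U" "smooth_on U f" "p \<in> U" "u \<in> Basis" "v \<in> Basis"
  shows "frechet_derivative (\<lambda>q. frechet_derivative f (at q) u) (at p) v =
    frechet_derivative (\<lambda>q. frechet_derivative f (at q) v) (at p) u"
  using assms
  by (intro mixed_derivatives_commute[of U])
    (auto intro: smooth_on_imp_differentiable smooth_on_imp_continuous_on smooth_on_derivative)

section \<open>Derivatives of functions of position and direction\<close>

text \<open>All three operators \<open>pdx\<close>, \<open>pdy\<close> and \<open>delta\<close> are directional derivatives of the uncurried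
  function, so that their calculus follows from that of \<open>dir2\<close>.\<close>

definition diff2 :: "('a::euclidean_space \<Rightarrow> 'b::euclidean_space \<Rightarrow> real) \<Rightarrow> 'a \<Rightarrow> 'b \<Rightarrow> bool" where
  "diff2 F x y \<longleftrightarrow> (\<lambda>p. F (fst p) (snd p)) differentiable (at (x, y))"

definition dir2 :: "('a::euclidean_space \<Rightarrow> 'b::euclidean_space \<Rightarrow> real) \<Rightarrow> 'a \<Rightarrow> 'b \<Rightarrow> 'a \<times> 'b \<Rightarrow> real" where
  "dir2 F x y v = frechet_derivative (\<lambda>p. F (fst p) (snd p)) (at (x, y)) v"

lemma dir2_has_derivative:
  "diff2 F x y \<Longrightarrow> ((\<lambda>p. F (fst p) (snd p)) has_derivative dir2 F x y) (at (x, y))"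
  unfolding diff2_def dir2_def by (simp add: frechet_derivative_works)

text \<open>Differentiability and value are bundled, so that each rule below needs a single
  \<open>has_derivative\<close> fact.\<close>

lemma dir2_eqI:
  "((\<lambda>p. F (fst p) (snd p)) has_derivative D) (at (x, y)) \<Longrightarrow> diff2 F x y \<and> dir2 F x y v = D v"
  unfolding diff2_def dir2_def using frechet_derivative_at[of "\<lambda>p. F (fst p) (snd p)" D]
  by (auto simp: differentiable_def)

lemma linear_dir2: "diff2 F x y \<Longrightarrow> linear (dir2 F x y)"
  using dir2_has_derivative has_derivative_linear by blast

lemma diff2_const: "diff2 (\<lambda>x y. c) x y" and dir2_const: "dir2 (\<lambda>x y. c) x y v = 0"
proof -
  have "((\<lambda>p. c) has_derivative (\<lambda>v. 0)) (at (x, y))" by (rule has_derivative_const)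
  from dir2_eqI[of "\<lambda>x y. c", OF this] show "diff2 (\<lambda>x y. c) x y" "dir2 (\<lambda>x y. c) x y v = 0" by auto
qed

lemma diff2_coord: "diff2 (\<lambda>x y. y $ i) x y"
  and dir2_coord: "dir2 (\<lambda>x y. y $ i) x y v = snd v $ i"
proof -
  have "((\<lambda>p. snd p $ i) has_derivative (\<lambda>v. snd v $ i)) (at (x, y))"
    by (intro bounded_linear_imp_has_derivative bounded_linear_compose[OF bounded_linear_vec_nth bounded_linear_snd])
  from dir2_eqI[of "\<lambda>x y. y $ i", OF this]
  show "diff2 (\<lambda>x y. y $ i) x y" "dir2 (\<lambda>x y. y $ i) x y v = snd v $ i" by auto
qed

lemma diff2_fst: "f differentiable (at x) \<Longrightarrow> diff2 (\<lambda>x y. f x) x y"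
  and dir2_fst: "f differentiable (at x) \<Longrightarrow> dir2 (\<lambda>x y. f x) x y v = frechet_derivative f (at x) (fst v)"
proof -
  assume "f differentiable (at x)"
  then have "(f has_derivative frechet_derivative f (at x)) (at (fst (x, y)))"
    by (simp add: frechet_derivative_works)
  from has_derivative_compose[OF has_derivative_fst[OF has_derivative_ident] this]
  have "((\<lambda>p. f (fst p)) has_derivative (\<lambda>v. frechet_derivative f (at x) (fst v))) (at (x, y))" by simp
  from dir2_eqI[of "\<lambda>x y. f x", OF this]
  show "diff2 (\<lambda>x y. f x) x y" "dir2 (\<lambda>x y. f x) x y v = frechet_derivative f (at x) (fst v)" by auto
qed

lemma
  assumes "diff2 F x y" "diff2 G x y"
  shows diff2_add: "diff2 (\<lambda>x y. F x y + G x y) x y"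
    and dir2_add: "dir2 (\<lambda>x y. F x y + G x y) x y v = dir2 F x y v + dir2 G x y v"
    and diff2_diff: "diff2 (\<lambda>x y. F x y - G x y) x y"
    and dir2_diff: "dir2 (\<lambda>x y. F x y - G x y) x y v = dir2 F x y v - dir2 G x y v"
    and diff2_mult: "diff2 (\<lambda>x y. F x y * G x y) x y"
    and dir2_mult: "dir2 (\<lambda>x y. F x y * G x y) x y v = F x y * dir2 G x y v + dir2 F x y v * G x y"
  using dir2_eqI[of "\<lambda>x y. F x y + G x y", OF has_derivative_add[OF assms[THEN dir2_has_derivative]], of v]
    dir2_eqI[of "\<lambda>x y. F x y - G x y", OF has_derivative_diff[OF assms[THEN dir2_has_derivative]], of v]
    dir2_eqI[of "\<lambda>x y. F x y * G x y", OF has_derivative_mult[OF assms[THEN dir2_has_derivative]], of v]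
  by auto

lemma
  assumes "\<And>i. i \<in> I \<Longrightarrow> diff2 (F i) x y"
  shows diff2_sum: "diff2 (\<lambda>x y. \<Sum>i\<in>I. F i x y) x y"
    and dir2_sum: "dir2 (\<lambda>x y. \<Sum>i\<in>I. F i x y) x y v = (\<Sum>i\<in>I. dir2 (F i) x y v)"
proof -
  have "((\<lambda>p. \<Sum>i\<in>I. F i (fst p) (snd p)) has_derivative (\<lambda>v. \<Sum>i\<in>I. dir2 (F i) x y v)) (at (x, y))"
    by (intro has_derivative_sum dir2_has_derivative assms)
  from dir2_eqI[of "\<lambda>x y. \<Sum>i\<in>I. F i x y", OF this]
  show "diff2 (\<lambda>x y. \<Sum>i\<in>I. F i x y) x y"
    "dir2 (\<lambda>x y. \<Sum>i\<in>I. F i x y) x y v = (\<Sum>i\<in>I. dir2 (F i) x y v)" by auto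
qed

text \<open>Identities such as Euler's relation hold only over the chart image and away from the
  zero section; being valid on an open set, they may be differentiated there.\<close>

lemma
  assumes "open W" "(x, y) \<in> W" "diff2 G x y" "\<And>x y. (x, y) \<in> W \<Longrightarrow> F x y = G x y"
  shows diff2_transform: "diff2 F x y" and dir2_transform: "dir2 F x y v = dir2 G x y v"
proof -
  have "((\<lambda>p. F (fst p) (snd p)) has_derivative dir2 G x y) (at (x, y))"
    using assms by (intro has_derivative_transform_within_open[OF dir2_has_derivative[OF assms(3)] assms(1,2)]) auto
  from dir2_eqI[OF this] show "diff2 F x y" "dir2 F x y v = dir2 G x y v" by auto
qed

lemmas diff2_intros = diff2_const diff2_coord diff2_fst diff2_add diff2_diff diff2_mult diff2_sum
lemmas dir2_simps = dir2_const dir2_coord dir2_fst dir2_add dir2_diff dir2_mult dir2_sum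

lemma pdx_eq_dir2:
  assumes "diff2 F x y"
  shows "pdx i F x y = dir2 F x y (axis i 1, 0)"
proof -
  have "((\<lambda>z. (z, y)) has_derivative (\<lambda>h. (h, 0))) (at x)"
    by (auto intro!: derivative_eq_intros)
  from has_derivative_compose[OF this dir2_has_derivative[OF assms]]
  show ?thesis unfolding pdx_def
    by (metis (no_types, lifting) ext frechet_derivative_at fst_conv snd_conv)
qed

lemma pdy_eq_dir2:
  assumes "diff2 F x y"
  shows "pdy i F x y = dir2 F x y (0, axis i 1)"
proof -
  have "((\<lambda>z. (x, z)) has_derivative (\<lambda>h. (0, h))) (at y)"
    by (auto intro!: derivative_eq_intros)
  from has_derivative_compose[OF this dir2_has_derivative[OF assms]]
  show ?thesis unfolding pdy_def
    by (metis (no_types, lifting) ext frechet_derivative_at fst_conv snd_conv)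
qed

text \<open>Linearity of the derivative on the vertical basis vectors. With \<open>w = y\<close> it
  yields Euler's relation; with minus a column of the nonlinear connection it yields the vertical
  part of \<open>delta\<close>.\<close>

lemma dir2_vertical:
  fixes F :: "real ^ 'n \<Rightarrow> real ^ 'n \<Rightarrow> real"
  assumes "diff2 F x y"
  shows "dir2 F x y (0, w) = (\<Sum>r\<in>UNIV. w $ r * pdy r F x y)"
proof -
  have "(0 :: real ^ 'n, w) = (\<Sum>r\<in>UNIV. w $ r *\<^sub>R (0, axis r 1))"
    by (simp add: vec_eq_iff prod_eq_iff fst_sum snd_sum axis_def if_distrib cong: if_cong)
  then have "dir2 F x y (0, w) = (\<Sum>r\<in>UNIV. dir2 F x y (w $ r *\<^sub>R (0, axis r 1)))"
    using linear_sum[OF linear_dir2[OF assms]] by metis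
  then show ?thesis
    using linear_scale[OF linear_dir2[OF assms]] by (simp add: pdy_eq_dir2[OF assms] del: scaleR_Pair)
qed

text \<open>\<open>delta L k\<close> differentiates along the horizontal lift of the k-th coordinate
  vector, so it inherits the sum and product rules from \<open>dir2\<close>.\<close>

lemma delta_eq_dir2:
  assumes "diff2 F x y"
  shows "delta L k F x y = dir2 F x y (axis k 1, - (\<chi> r. nonlin_conn L r k x y))"
proof -
  have "dir2 F x y ((axis k 1, 0) + (0, - (\<chi> r. nonlin_conn L r k x y))) =
      dir2 F x y (axis k 1, 0) + dir2 F x y (0, - (\<chi> r. nonlin_conn L r k x y))"
    by (rule linear_add[OF linear_dir2[OF assms]])
  then show ?thesis
    by (simp add: delta_def pdx_eq_dir2[OF assms] dir2_vertical[OF assms] sum_negf)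
qed

section \<open>Differentiability of the matrix inverse\<close>

lemma differentiable_det:
  fixes M :: "'a::real_normed_vector \<Rightarrow> real ^ 'n ^ 'n"
  assumes "\<And>i j. (\<lambda>p. M p $ i $ j) differentiable (at a)"
  shows "(\<lambda>p. det (M p)) differentiable (at a)"
proof -
  have "(\<lambda>p. \<Prod>i\<in>UNIV. M p $ i $ q i) differentiable (at a)" for q
  proof -
    have "\<forall>i. \<exists>D. ((\<lambda>p. M p $ i $ q i) has_derivative D) (at a)"
      using assms by (auto simp: differentiable_def)
    then obtain D where "\<And>i. ((\<lambda>p. M p $ i $ q i) has_derivative D i) (at a)" by metis
    from has_derivative_prod[of UNIV "\<lambda>i p. M p $ i $ q i", OF this]
    show ?thesis by (auto simp: differentiable_def)
  qed
  then show ?thesis unfolding det_def by (intro derivative_intros) (auto simp: finite_permutations)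
qed

lemma matrix_inv_inverse:
  fixes M :: "real ^ 'n ^ 'n"
  assumes "det M \<noteq> 0"
  shows "M ** matrix_inv M = mat 1" "matrix_inv M ** M = mat 1"
  using assms someI_ex[of "\<lambda>M'. M ** M' = mat 1 \<and> M' ** M = mat 1"]
  unfolding matrix_inv_def invertible_det_nz[symmetric] invertible_def by auto

text \<open>The j-th column of the inverse solves the linear system with right-hand side
  \<open>axis j 1\<close>, to which Cramer's rule applies. A quotient of determinants is visibly
  differentiable in the entries.\<close>

lemma matrix_inv_cramer:
  fixes M :: "real ^ 'n ^ 'n"
  assumes "det M \<noteq> 0"
  shows "matrix_inv M $ i $ j = det (\<chi> k l. if l = i then axis j 1 $ k else M $ k $ l) / det M"
proof -
  have "M ** matrix_inv M = mat 1"
    using assms by (rule matrix_inv_inverse)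
  then have "M *v (matrix_inv M *v axis j 1) = axis j 1"
    by (simp add: matrix_vector_mul_assoc)
  then have "matrix_inv M *v axis j 1 =
      (\<chi> i. det (\<chi> k l. if l = i then axis j 1 $ k else M $ k $ l) / det M)"
    using cramer[OF assms] by blast
  then show ?thesis
    by (metis (no_types, lifting) matrix_vector_mult_basis column_def vec_lambda_beta)
qed

text \<open>Cramer's formula has to represent the inverse near \<open>a\<close>, not only at
  \<open>a\<close>, so the determinant is required to be nonzero on an open set.\<close>

lemma differentiable_matrix_inv:
  fixes M :: "'a::real_normed_vector \<Rightarrow> real ^ 'n ^ 'n"
  assumes "open W" "a \<in> W" "\<And>p. p \<in> W \<Longrightarrow> det (M p) \<noteq> 0"
    and M: "\<And>i j. (\<lambda>p. M p $ i $ j) differentiable (at a)"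
  shows "(\<lambda>p. matrix_inv (M p) $ i $ j) differentiable (at a)"
proof -
  have "(\<lambda>p. (\<chi> k l. if l = i then axis j 1 $ k else M p $ k $ l) $ k $ l) differentiable (at a)" for k l
    using M by (cases "l = i") auto
  then have "(\<lambda>p. det (\<chi> k l. if l = i then axis j 1 $ k else M p $ k $ l) / det (M p)) differentiable (at a)"
    using assms(2,3) M by (intro differentiable_divide differentiable_det) auto
  then obtain D where "((\<lambda>p. det (\<chi> k l. if l = i then axis j 1 $ k else M p $ k $ l) / det (M p))
      has_derivative D) (at a)"
    by (auto simp: differentiable_def)
  from has_derivative_transform_within_open[OF this assms(1,2)]
  have "((\<lambda>p. matrix_inv (M p) $ i $ j) has_derivative D) (at a)"
    by (simp add: matrix_inv_cramer[OF assms(3)])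
  then show ?thesis by (auto simp: differentiable_def)
qed

section \<open>Smooth functions of position and direction\<close>

definition smooth2 :: "('a::euclidean_space \<times> 'b::euclidean_space) set \<Rightarrow> ('a \<Rightarrow> 'b \<Rightarrow> real) \<Rightarrow> bool" where
  "smooth2 W F \<longleftrightarrow> smooth_on W (\<lambda>p. F (fst p) (snd p))"

lemma smooth2_diff2: "smooth2 W F \<Longrightarrow> (x, y) \<in> W \<Longrightarrow> diff2 F x y"
  unfolding smooth2_def diff2_def by (rule smooth_on_imp_differentiable)

lemma smooth2_mult:
  "open W \<Longrightarrow> smooth2 W F \<Longrightarrow> smooth2 W G \<Longrightarrow> smooth2 W (\<lambda>x y. F x y * G x y)"
  unfolding smooth2_def by (rule smooth_on_mult)

lemma smooth2_dir2: "smooth2 W F \<Longrightarrow> v \<in> Basis \<Longrightarrow> smooth2 W (\<lambda>x y. dir2 F x y v)"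
  unfolding smooth2_def dir2_def by (simp add: smooth_on_derivative)

lemma smooth2_cong:
  "open W \<Longrightarrow> smooth2 W F \<Longrightarrow> (\<And>x y. (x, y) \<in> W \<Longrightarrow> F x y = G x y) \<Longrightarrow> smooth2 W G"
  unfolding smooth2_def by (erule (1) smooth_on_cong) auto

lemma dir2_commute:
  assumes "open W" "smooth2 W F" "(x, y) \<in> W" "u \<in> Basis" "v \<in> Basis"
  shows "dir2 (\<lambda>x y. dir2 F x y u) x y v = dir2 (\<lambda>x y. dir2 F x y v) x y u"
  using smooth_on_mixed_derivatives_commute[OF assms(1) assms(2)[unfolded smooth2_def] assms(3-5)]
  unfolding dir2_def by simp

text \<open>\<open>Ck_on\<close> controls derivatives along \<open>Basis\<close> vectors; these two
  are the directions of \<open>pdx\<close> and \<open>pdy\<close>.\<close>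

lemma axis_0_Basis: "(axis i (1 :: real), 0) \<in> Basis" "(0, axis i (1 :: real)) \<in> Basis"
  for i :: "'n::finite"
proof -
  have "axis i (1 :: real) \<in> Basis" by (auto simp: Basis_vec_def)
  then show "(axis i (1 :: real), 0) \<in> Basis" "(0, axis i (1 :: real)) \<in> Basis"
    unfolding Basis_prod_def by (simp_all only: Un_iff image_iff prod.inject) metis+
qed

context
  fixes W :: "((real ^ 'n) \<times> (real ^ 'n)) set" and F :: "real ^ 'n \<Rightarrow> real ^ 'n \<Rightarrow> real"
  assumes W: "open W" and F: "smooth2 W F"
begin

lemma smooth2_pdx: "smooth2 W (pdx i F)"
  by (rule smooth2_cong[OF W smooth2_dir2[OF F axis_0_Basis(1)[of i]]])
    (simp add: pdx_eq_dir2 smooth2_diff2[OF F])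

lemma smooth2_pdy: "smooth2 W (pdy i F)"
  by (rule smooth2_cong[OF W smooth2_dir2[OF F axis_0_Basis(2)[of i]]])
    (simp add: pdy_eq_dir2 smooth2_diff2[OF F])

lemma dir2_pdx: "(x, y) \<in> W \<Longrightarrow> dir2 (pdx i F) x y v = dir2 (\<lambda>x y. dir2 F x y (axis i 1, 0)) x y v"
  by (rule dir2_transform[OF W _ smooth2_diff2[OF smooth2_dir2[OF F]]])
    (auto simp: axis_0_Basis pdx_eq_dir2 smooth2_diff2[OF F])

lemma dir2_pdy: "(x, y) \<in> W \<Longrightarrow> dir2 (pdy i F) x y v = dir2 (\<lambda>x y. dir2 F x y (0, axis i 1)) x y v"
  by (rule dir2_transform[OF W _ smooth2_diff2[OF smooth2_dir2[OF F]]])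
    (auto simp: axis_0_Basis pdy_eq_dir2 smooth2_diff2[OF F])

lemma pdy_pdx_commute: "(x, y) \<in> W \<Longrightarrow> pdy i (pdx j F) x y = pdx j (pdy i F) x y"
  by (simp add: pdx_eq_dir2[of "pdy i F"] pdy_eq_dir2[of "pdx j F"] smooth2_diff2[OF smooth2_pdx]
      smooth2_diff2[OF smooth2_pdy] dir2_pdx dir2_pdy dir2_commute[OF W F] axis_0_Basis)

lemma pdy_pdy_commute: "(x, y) \<in> W \<Longrightarrow> pdy i (pdy j F) x y = pdy j (pdy i F) x y"
  by (simp add: pdy_eq_dir2[of "pdy i F"] pdy_eq_dir2[of "pdy j F"]
      smooth2_diff2[OF smooth2_pdy] dir2_pdy dir2_commute[OF W F, of _ _ "(0, axis j 1)"] axis_0_Basis)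

end

section \<open>Rules for \<open>pdx\<close>, \<open>pdy\<close> and \<open>delta\<close>\<close>

lemma sum_axis: "(\<Sum>i\<in>UNIV. axis k 1 $ i * f i) = (f k :: real)" "(\<Sum>i\<in>UNIV. f i * axis k 1 $ i) = (f k :: real)"
  by (simp_all add: axis_def if_distrib if_distribR cong: if_cong)

lemma
  assumes "diff2 F x y" "diff2 G x y"
  shows pdy_add: "pdy k (\<lambda>x y. F x y + G x y) x y = pdy k F x y + pdy k G x y"
    and delta_add: "delta L k (\<lambda>x y. F x y + G x y) x y = delta L k F x y + delta L k G x y"
    and pdy_minus: "pdy k (\<lambda>x y. F x y - G x y) x y = pdy k F x y - pdy k G x y"
    and pdx_mult: "pdx k (\<lambda>x y. F x y * G x y) x y = F x y * pdx k G x y + pdx k F x y * G x y"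
    and pdy_mult: "pdy k (\<lambda>x y. F x y * G x y) x y = F x y * pdy k G x y + pdy k F x y * G x y"
    and delta_mult: "delta L k (\<lambda>x y. F x y * G x y) x y = F x y * delta L k G x y + delta L k F x y * G x y"
  using assms
  by (simp_all add: pdx_eq_dir2 pdy_eq_dir2 delta_eq_dir2 diff2_intros dir2_simps)

lemma
  assumes "diff2 F x y"
  shows pdx_divide: "pdx k (\<lambda>x y. F x y / c) x y = pdx k F x y / c"
    and pdy_divide: "pdy k (\<lambda>x y. F x y / c) x y = pdy k F x y / c"
  using assms unfolding divide_inverse
  by (simp_all add: pdx_eq_dir2 pdy_eq_dir2 diff2_intros dir2_simps)

lemma
  assumes "\<And>i. i \<in> I \<Longrightarrow> diff2 (F i) x y"
  shows pdx_sum: "pdx k (\<lambda>x y. \<Sum>i\<in>I. F i x y) x y = (\<Sum>i\<in>I. pdx k (F i) x y)"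
    and pdy_sum: "pdy k (\<lambda>x y. \<Sum>i\<in>I. F i x y) x y = (\<Sum>i\<in>I. pdy k (F i) x y)"
    and delta_sum: "delta L k (\<lambda>x y. \<Sum>i\<in>I. F i x y) x y = (\<Sum>i\<in>I. delta L k (F i) x y)"
  using assms
  by (simp_all add: pdx_eq_dir2 pdy_eq_dir2 delta_eq_dir2 diff2_sum dir2_sum)

lemma pdx_const: "pdx k (\<lambda>x y. c) x y = 0"
  and pdy_const: "pdy k (\<lambda>x y. c) x y = 0"
  and delta_const: "delta L k (\<lambda>x y. c) x y = 0"
  by (simp_all add: pdx_eq_dir2 pdy_eq_dir2 delta_eq_dir2 diff2_intros dir2_simps)

lemma pdx_coord: "pdx k (\<lambda>x y. y $ i) x y = 0"
  and pdy_coord: "pdy k (\<lambda>x y. y $ i) x y = axis k 1 $ i"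
  and delta_coord: "delta L k (\<lambda>x y. y $ i) x y = - nonlin_conn L i k x y"
  by (simp_all add: pdx_eq_dir2 pdy_eq_dir2 delta_eq_dir2 diff2_intros dir2_simps)

lemma
  assumes "open W" "(x, y) \<in> W" "diff2 G x y" "\<And>x y. (x, y) \<in> W \<Longrightarrow> F x y = G x y"
  shows pdx_transform: "pdx k F x y = pdx k G x y"
    and pdy_transform: "pdy k F x y = pdy k G x y"
    and delta_transform: "delta L k F x y = delta L k G x y"
  using diff2_transform[OF assms] dir2_transform[OF assms] assms(3)
  by (simp_all add: pdx_eq_dir2 pdy_eq_dir2 delta_eq_dir2)

lemmas pdx_rules = pdx_divide pdx_mult pdx_sum pdx_const pdx_coord
lemmas pdy_rules = pdy_divide pdy_add pdy_minus pdy_mult pdy_sum pdy_const pdy_coord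
lemmas delta_rules = delta_add delta_mult delta_sum delta_const delta_coord

section \<open>The Cartan connection in a chart\<close>

text \<open>The conditions of \<open>finsler_metric\<close> in one chart with open image
  \<open>V\<close>, so that the tensor calculus takes place in an open subset of
  \<open>real ^ 'n\<close>.\<close>

locale finsler_chart =
  fixes V :: "(real ^ 'n) set" and L :: "real ^ 'n \<Rightarrow> real ^ 'n \<Rightarrow> real"
  assumes open_V: "open V"
    and smooth_L: "smooth_on (V \<times> - {0}) (\<lambda>(x, y). L x y)"
    and L_pos: "x \<in> V \<Longrightarrow> y \<noteq> 0 \<Longrightarrow> L x y > 0"
    and L_homogeneous: "x \<in> V \<Longrightarrow> t > 0 \<Longrightarrow> L x (t *\<^sub>R y) = t * L x y"
    and metric_pos: "x \<in> V \<Longrightarrow> y \<noteq> 0 \<Longrightarrow> v \<noteq> 0 \<Longrightarrow>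
      (\<Sum>i\<in>UNIV. \<Sum>j\<in>UNIV. metric L i j x y * v $ i * v $ j) > 0"
begin

abbreviation "W \<equiv> V \<times> (- {0 :: real ^ 'n})"

lemma open_W: "open W"
  using open_V by (intro open_Times) auto

lemma smooth2_L: "smooth2 W L"
  using smooth_L by (simp add: smooth2_def case_prod_unfold)

lemma smooth2_sq: "smooth2 W (sq L)"
  using smooth2_mult[OF open_W smooth2_L smooth2_L] by (simp add: sq_def power2_eq_square)

lemmas smooth2_pd = smooth2_pdx[OF open_W] smooth2_pdy[OF open_W] smooth2_L smooth2_sq

lemma diff2_L:
  assumes "(x, y) \<in> W"
  shows "diff2 L x y" "diff2 (pdy i L) x y" "diff2 (pdy i (pdy j L)) x y"
    "diff2 (sq L) x y" "diff2 (pdy i (sq L)) x y" "diff2 (pdx i (sq L)) x y"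
    "diff2 (pdy i (pdy j (sq L))) x y" "diff2 (pdx i (pdy j (sq L))) x y"
  by (rule smooth2_diff2[OF _ assms], intro smooth2_pd)+

lemma diff2_metric: "(x, y) \<in> W \<Longrightarrow> diff2 (metric L i j) x y"
  unfolding metric_def by (intro diff2_intros diff2_L)

text \<open>Differentiate the homogeneity relation along the ray through \<open>y\<close>, in the
  factor \<open>t\<close> at 1.\<close>

lemma euler_L:
  assumes "(x, y) \<in> W"
  shows "(\<Sum>i\<in>UNIV. y $ i * pdy i L x y) = L x y"
proof -
  have "((\<lambda>t. (x, t *\<^sub>R y)) has_derivative (\<lambda>d. (0, d *\<^sub>R y))) (at 1)"
    by (auto intro!: derivative_eq_intros)
  moreover have "((\<lambda>p. L (fst p) (snd p)) has_derivative dir2 L x y) (at (x, 1 *\<^sub>R y))"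
    using dir2_has_derivative[OF diff2_L(1)[OF assms]] by simp
  ultimately have "((\<lambda>t. L (fst (x, t *\<^sub>R y)) (snd (x, t *\<^sub>R y))) has_derivative (\<lambda>d. dir2 L x y (0, d *\<^sub>R y))) (at 1)"
    by (rule has_derivative_compose)
  then have "((\<lambda>t. t * L x y) has_derivative (\<lambda>d. dir2 L x y (0, d *\<^sub>R y))) (at 1)"
    \<comment> \<open>Homogeneity is available for positive factors, so the two functions are
      compared on the open half-line, which contains 1.\<close>
    using assms by (elim has_derivative_transform_within_open[where s = "{0<..}"]) (auto simp: L_homogeneous)
  moreover have "((\<lambda>t. t * L x y) has_derivative (\<lambda>d. d * L x y)) (at 1)"
    by (auto intro!: derivative_eq_intros)
  ultimately have "(\<lambda>d. dir2 L x y (0, d *\<^sub>R y)) = (\<lambda>d. d * L x y)"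
    by (rule has_derivative_unique)
  from fun_cong[OF this, of 1] show ?thesis
    using dir2_vertical[OF diff2_L(1)[OF assms], of y] by simp
qed

lemma pdy_sq: "(x, y) \<in> W \<Longrightarrow> pdy i (sq L) x y = 2 * L x y * pdy i L x y"
  by (simp add: sq_def power2_eq_square pdy_mult diff2_L)

lemma euler_sq:
  assumes "(x, y) \<in> W"
  shows "(\<Sum>i\<in>UNIV. y $ i * pdy i (sq L) x y) = 2 * sq L x y"
proof -
  have "(\<Sum>i\<in>UNIV. y $ i * pdy i (sq L) x y) = 2 * L x y * (\<Sum>i\<in>UNIV. y $ i * pdy i L x y)"
    by (simp add: pdy_sq[OF assms] sum_distrib_left mult_ac)
  then show ?thesis by (simp add: euler_L[OF assms] sq_def power2_eq_square)
qed

lemma metric_sym: "(x, y) \<in> W \<Longrightarrow> metric L i j x y = metric L j i x y"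
  by (simp add: metric_def pdy_pdy_commute[OF open_W smooth2_sq, of x y i j])

text \<open>The Euler relation for L^2, differentiated in \<open>y\<close>: the factor
  \<open>y $ j\<close> contributes one copy of \<open>pdy i (sq L)\<close>, the right-hand side
  two.\<close>

lemma metric_y:
  assumes "(x, y) \<in> W"
  shows "(\<Sum>j\<in>UNIV. y $ j * metric L i j x y) = 1/2 * pdy i (sq L) x y"
proof -
  have "pdy i (\<lambda>x y. \<Sum>j\<in>UNIV. y $ j * pdy j (sq L) x y) x y = pdy i (\<lambda>x y. 2 * sq L x y) x y"
    by (rule pdy_transform[OF open_W assms]) (auto intro!: diff2_intros diff2_L assms euler_sq)
  then show ?thesis
    using assms
    by (simp add: pdy_rules diff2_intros diff2_L sum.distrib sum_axis metric_def sum_distrib_left[symmetric]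
        flip: sum_divide_distrib)
qed

text \<open>\<open>pdy k (metric L i j)\<close> is half a third derivative of L^2, that is, twice
  the Cartan tensor, and hence totally symmetric.\<close>

lemma metric_dy_sym: "(x, y) \<in> W \<Longrightarrow> pdy k (metric L i j) x y = pdy i (metric L k j) x y"
  unfolding metric_def
  by (simp add: pdy_rules diff2_intros diff2_L pdy_pdy_commute[OF open_W smooth2_pdy[OF open_W smooth2_sq], of x y i k])

lemma
  assumes "(x, y) \<in> W"
  shows pdx_metric_sym: "pdx k (metric L i j) x y = pdx k (metric L j i) x y"
    and pdy_metric_sym: "pdy k (metric L i j) x y = pdy k (metric L j i) x y"
    and delta_metric_sym: "delta L' k (metric L i j) x y = delta L' k (metric L j i) x y"
  using pdx_transform[OF open_W assms diff2_metric[OF assms] metric_sym]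
    pdy_transform[OF open_W assms diff2_metric[OF assms] metric_sym]
    delta_transform[OF open_W assms diff2_metric[OF assms] metric_sym] by auto

text \<open>Differentiating \<open>metric_y\<close> in \<open>y\<close>: the factor
  \<open>y $ j\<close> produces \<open>metric L i k\<close>, which is also the derivative of the
  right-hand side. So \<open>y\<close> annihilates the Cartan tensor.\<close>

lemma metric_dy_y:
  assumes "(x, y) \<in> W"
  shows "(\<Sum>j\<in>UNIV. y $ j * pdy k (metric L i j) x y) = 0"
proof -
  have "pdy k (\<lambda>x y. \<Sum>j\<in>UNIV. y $ j * metric L i j x y) x y = pdy k (\<lambda>x y. 1/2 * pdy i (sq L) x y) x y"
    by (rule pdy_transform[OF open_W assms]) (auto intro!: diff2_intros diff2_L assms simp del: times_divide_eq_left simp: metric_y)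
  moreover have "pdy k (\<lambda>x y. 1/2 * pdy i (sq L) x y) x y = metric L k i x y"
    by (simp add: metric_def pdy_rules diff2_intros diff2_L[OF assms])
  ultimately show ?thesis
    using assms
    by (simp add: pdy_rules diff2_intros diff2_metric sum.distrib sum_axis metric_sym[OF assms, of k i])
qed

lemma metric_dx_y:
  assumes "(x, y) \<in> W"
  shows "(\<Sum>j\<in>UNIV. y $ j * pdx k (metric L i j) x y) = 1/2 * pdx k (pdy i (sq L)) x y"
proof -
  have "pdx k (\<lambda>x y. \<Sum>j\<in>UNIV. y $ j * metric L i j x y) x y = pdx k (\<lambda>x y. 1/2 * pdy i (sq L) x y) x y"
    by (rule pdx_transform[OF open_W assms]) (auto intro!: diff2_intros diff2_L assms simp del: times_divide_eq_left simp: metric_y)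
  then show ?thesis
    using assms by (simp add: pdx_rules diff2_intros diff2_metric diff2_L)
qed

lemma euler_pdx_sq:
  assumes "(x, y) \<in> W"
  shows "(\<Sum>j\<in>UNIV. y $ j * pdx k (pdy j (sq L)) x y) = 2 * pdx k (sq L) x y"
proof -
  have "pdx k (\<lambda>x y. \<Sum>j\<in>UNIV. y $ j * pdy j (sq L) x y) x y = pdx k (\<lambda>x y. 2 * sq L x y) x y"
    by (rule pdx_transform[OF open_W assms]) (auto intro!: diff2_intros diff2_L assms euler_sq)
  then show ?thesis
    using assms by (simp add: pdx_rules diff2_intros diff2_L)
qed

lemma pdy_pdx_pdy_sq:
  assumes "(x, y) \<in> W"
  shows "pdy k (pdx j (pdy i (sq L))) x y = 2 * pdx j (metric L i k) x y"
proof -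
  have "pdy k (pdx j (pdy i (sq L))) x y = pdx j (pdy k (pdy i (sq L))) x y"
    by (rule pdy_pdx_commute[OF open_W smooth2_pdy[OF open_W smooth2_sq] assms])
  also have "\<dots> = 2 * pdx j (metric L k i) x y"
    unfolding metric_def by (simp add: pdx_rules diff2_intros diff2_L[OF assms])
  finally show ?thesis by (simp add: pdx_metric_sym[OF assms, of j k])
qed

section \<open>The inverse metric, the spray and the nonlinear connection\<close>

abbreviation metric_matrix where
  "metric_matrix x y \<equiv> (\<chi> k l. metric L k l x y)"

lemma det_metric:
  assumes "(x, y) \<in> W"
  shows "det (metric_matrix x y) \<noteq> 0"
proof -
  have "v = 0" if "metric_matrix x y *v v = 0" for v
  proof (rule ccontr)
    assume "v \<noteq> 0"
    moreover have "(\<Sum>j\<in>UNIV. metric L i j x y * v $ j) = 0" for i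
      using that by (simp add: vec_eq_iff matrix_vector_mult_def)
    then have "(\<Sum>i\<in>UNIV. v $ i * (\<Sum>j\<in>UNIV. metric L i j x y * v $ j)) = 0" by simp
    then have "(\<Sum>i\<in>UNIV. \<Sum>j\<in>UNIV. metric L i j x y * v $ i * v $ j) = 0"
      by (simp add: sum_distrib_left mult_ac)
    ultimately show False using metric_pos[of x y v] assms by auto
  qed
  then show ?thesis
    by (metis invertible_det_nz invertible_left_inverse matrix_left_invertible_ker)
qed

lemma metric_raise:
  assumes "(x, y) \<in> W"
  shows "(\<Sum>r\<in>UNIV. metric L i r x y * (\<Sum>s\<in>UNIV. metric_inv L r s x y * c s)) = c i"
proof -
  have "metric_matrix x y *v (matrix_inv (metric_matrix x y) *v (\<chi> s. c s)) = (\<chi> s. c s)"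
    by (simp add: matrix_vector_mul_assoc matrix_inv_inverse[OF det_metric[OF assms]])
  then show ?thesis
    by (simp add: vec_eq_iff matrix_vector_mult_def metric_inv_def)
qed

text \<open>Nondegeneracy of the metric. Identities with an upper index are proved below after
  lowering that index, where \<open>metric_inv\<close> no longer occurs.\<close>

lemma metric_cancel:
  assumes "(x, y) \<in> W" "\<And>i. (\<Sum>r\<in>UNIV. metric L i r x y * a r) = (\<Sum>r\<in>UNIV. metric L i r x y * b r)"
  shows "a r = b r"
proof -
  have "metric_matrix x y *v (\<chi> r. a r) = metric_matrix x y *v (\<chi> r. b r)"
    using assms(2) by (simp add: vec_eq_iff matrix_vector_mult_def)
  then have "matrix_inv (metric_matrix x y) *v (metric_matrix x y *v (\<chi> r. a r)) =
      matrix_inv (metric_matrix x y) *v (metric_matrix x y *v (\<chi> r. b r))"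
    by simp
  then have "(\<chi> r. a r) = (\<chi> r. b r)"
    by (simp add: matrix_vector_mul_assoc matrix_inv_inverse[OF det_metric[OF assms(1)]])
  then show ?thesis by (simp add: vec_eq_iff)
qed

lemma diff2_metric_inv:
  assumes "(x, y) \<in> W"
  shows "diff2 (metric_inv L i j) x y"
  unfolding diff2_def metric_inv_def
  using diff2_metric[OF assms] det_metric
  by (intro differentiable_matrix_inv[OF open_W assms]) (auto simp: diff2_def)

lemma diff2_spray: "(x, y) \<in> W \<Longrightarrow> diff2 (spray L i) x y"
  unfolding spray_def by (intro diff2_intros diff2_L diff2_metric_inv)

lemma spray_lower:
  assumes "(x, y) \<in> W"
  shows "2 * (\<Sum>r\<in>UNIV. metric L i r x y * spray L r x y) =
    (\<Sum>k\<in>UNIV. y $ k * pdx k (pdy i (sq L)) x y) - pdx i (sq L) x y"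
proof -
  define c where "c r = (\<Sum>k\<in>UNIV. y $ k * pdx k (pdy r (sq L)) x y) - pdx r (sq L) x y" for r
  have "(\<Sum>s\<in>UNIV. metric_inv L r s x y * c s) = 2 * spray L r x y" for r
    by (simp add: spray_def c_def)
  then have "(\<Sum>r\<in>UNIV. metric L i r x y * (2 * spray L r x y)) = c i"
    using metric_raise[OF assms, of i c] by simp
  then show ?thesis by (simp add: c_def sum_distrib_left mult_ac)
qed

text \<open>By nondegeneracy the lowered equation characterises the spray. It is applied to the
  changed metric, with the spray of the original one as \<open>T\<close>.\<close>

lemma spray_unique:
  assumes "(x, y) \<in> W"
    and "\<And>i. 2 * (\<Sum>r\<in>UNIV. metric L i r x y * T r) =
      (\<Sum>k\<in>UNIV. y $ k * pdx k (pdy i (sq L)) x y) - pdx i (sq L) x y"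
  shows "spray L r x y = T r"
proof (rule metric_cancel[OF assms(1), of "\<lambda>r. spray L r x y"])
  show "(\<Sum>r\<in>UNIV. metric L i r x y * spray L r x y) = (\<Sum>r\<in>UNIV. metric L i r x y * T r)" for i
    using assms(2)[of i] spray_lower[OF assms(1), of i] by simp
qed

text \<open>The derivative of \<open>spray_lower\<close> with respect to \<open>y\<^sup>k\<close>.\<close>

lemma nonlin_conn_lower:
  assumes "(x, y) \<in> W"
  shows "4 * (\<Sum>r\<in>UNIV. metric L i r x y * nonlin_conn L r k x y) =
    2 * (\<Sum>j\<in>UNIV. y $ j * pdx j (metric L i k) x y) + pdx k (pdy i (sq L)) x y - pdx i (pdy k (sq L)) x y
    - 2 * (\<Sum>r\<in>UNIV. spray L r x y * pdy r (metric L i k) x y)"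
proof -
  have "pdy k (\<lambda>x y. 2 * (\<Sum>r\<in>UNIV. metric L i r x y * spray L r x y)) x y =
      pdy k (\<lambda>x y. (\<Sum>k\<in>UNIV. y $ k * pdx k (pdy i (sq L)) x y) - pdx i (sq L) x y) x y"
    by (rule pdy_transform[OF open_W assms]) (auto intro!: diff2_intros diff2_L assms spray_lower)
  moreover have "pdy k (\<lambda>x y. 2 * (\<Sum>r\<in>UNIV. metric L i r x y * spray L r x y)) x y =
      2 * (\<Sum>r\<in>UNIV. metric L i r x y * (2 * nonlin_conn L r k x y)) +
      2 * (\<Sum>r\<in>UNIV. spray L r x y * pdy r (metric L i k) x y)"
  proof -
    \<comment> \<open>Total symmetry of the Cartan tensor moves the differentiation index from
      \<open>k\<close> to the summation index \<open>r\<close>.\<close>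
    have "pdy k (metric L i r) x y = pdy r (metric L i k) x y" for r
      by (metis assms metric_dy_sym pdy_metric_sym)
    then show ?thesis
      using assms
      by (simp add: pdy_rules diff2_intros diff2_metric diff2_spray nonlin_conn_def sum.distrib mult_ac)
  qed
  \<comment> \<open>The bound index of the inner sum hides the fixed \<open>k\<close>;
    differentiating its factor \<open>y $ k\<close> leaves the single term with the fixed
    \<open>k\<close>.\<close>
  moreover have "pdy k (\<lambda>x y. (\<Sum>k\<in>UNIV. y $ k * pdx k (pdy i (sq L)) x y) - pdx i (sq L) x y) x y =
      (\<Sum>j\<in>UNIV. y $ j * (2 * pdx j (metric L i k) x y)) + pdx k (pdy i (sq L)) x y - pdx i (pdy k (sq L)) x y"
    using assms
    by (simp add: pdy_rules diff2_intros diff2_L sum.distrib sum_axis pdy_pdx_pdy_sq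
        pdy_pdx_commute[OF open_W smooth2_sq])
  ultimately show ?thesis
    by (simp add: sum_distrib_left mult_ac)
qed

end

section \<open>Contractions with \<open>y\<close> and metric compatibility\<close>

context finsler_chart
begin

text \<open>This is Euler's relation for a spray of degree 2. It is read off from
  \<open>nonlin_conn_lower\<close> contracted with \<open>y\<close>: the Cartan tensor term vanishes
  and the rest is twice the right-hand side of \<open>spray_lower\<close>.\<close>

lemma nonlin_conn_y:
  assumes "(x, y) \<in> W"
  shows "(\<Sum>k\<in>UNIV. y $ k * nonlin_conn L r k x y) = spray L r x y"
proof (rule metric_cancel[OF assms, of "\<lambda>r. \<Sum>k\<in>UNIV. y $ k * nonlin_conn L r k x y" "\<lambda>r. spray L r x y"])
  fix i
  let ?N = "\<lambda>r k. nonlin_conn L r k x y" and ?g = "\<lambda>i j. metric L i j x y"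
  have "(\<Sum>k\<in>UNIV. y $ k * (4 * (\<Sum>r\<in>UNIV. ?g i r * ?N r k))) =
      2 * (\<Sum>k\<in>UNIV. \<Sum>j\<in>UNIV. y $ k * (y $ j * pdx j (metric L i k) x y))
      + (\<Sum>k\<in>UNIV. y $ k * pdx k (pdy i (sq L)) x y) - (\<Sum>k\<in>UNIV. y $ k * pdx i (pdy k (sq L)) x y)
      - 2 * (\<Sum>k\<in>UNIV. \<Sum>r\<in>UNIV. y $ k * (spray L r x y * pdy r (metric L i k) x y))"
    unfolding nonlin_conn_lower[OF assms]
    by (simp add: sum_distrib_left sum.distrib sum_subtractf algebra_simps)
  also have "(\<Sum>k\<in>UNIV. \<Sum>j\<in>UNIV. y $ k * (y $ j * pdx j (metric L i k) x y)) =
      (\<Sum>j\<in>UNIV. y $ j * (\<Sum>k\<in>UNIV. y $ k * pdx j (metric L i k) x y))"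
    by (subst sum.swap) (simp add: sum_distrib_left mult_ac)
  also have "\<dots> = 1/2 * (\<Sum>j\<in>UNIV. y $ j * pdx j (pdy i (sq L)) x y)"
    by (simp add: metric_dx_y[OF assms] sum_distrib_left)
  also have "(\<Sum>k\<in>UNIV. \<Sum>r\<in>UNIV. y $ k * (spray L r x y * pdy r (metric L i k) x y)) =
      (\<Sum>r\<in>UNIV. spray L r x y * (\<Sum>k\<in>UNIV. y $ k * pdy r (metric L i k) x y))"
    by (subst sum.swap) (simp add: sum_distrib_left mult_ac)
  also have "\<dots> = 0"
    by (simp add: metric_dy_y[OF assms])
  finally have "(\<Sum>k\<in>UNIV. y $ k * (4 * (\<Sum>r\<in>UNIV. ?g i r * ?N r k))) = 4 * (\<Sum>r\<in>UNIV. ?g i r * spray L r x y)"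
    using spray_lower[OF assms, of i] by (simp add: euler_pdx_sq[OF assms])
  moreover have "(\<Sum>k\<in>UNIV. y $ k * (4 * (\<Sum>r\<in>UNIV. ?g i r * ?N r k))) =
      4 * (\<Sum>r\<in>UNIV. ?g i r * (\<Sum>k\<in>UNIV. y $ k * ?N r k))"
    by (simp add: sum_distrib_left mult_ac) (rule sum.swap)
  ultimately show "(\<Sum>r\<in>UNIV. ?g i r * (\<Sum>k\<in>UNIV. y $ k * ?N r k)) = (\<Sum>r\<in>UNIV. ?g i r * spray L r x y)"
    by simp
qed

lemma cartan_lower:
  assumes "(x, y) \<in> W"
  shows "2 * (\<Sum>r\<in>UNIV. metric L i r x y * cartan L r j k x y) =
    delta L j (metric L i k) x y + delta L k (metric L i j) x y - delta L i (metric L j k) x y"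
proof -
  define c where "c r = delta L j (metric L r k) x y + delta L k (metric L r j) x y - delta L r (metric L j k) x y" for r
  have "(\<Sum>s\<in>UNIV. metric_inv L r s x y * c s) = 2 * cartan L r j k x y" for r
    by (simp add: cartan_def c_def)
  then have "(\<Sum>r\<in>UNIV. metric L i r x y * (2 * cartan L r j k x y)) = c i"
    using metric_raise[OF assms, of i c] by simp
  then show ?thesis by (simp add: c_def sum_distrib_left mult_ac)
qed

lemma cartan_sym:
  assumes "(x, y) \<in> W"
  shows "cartan L i j k x y = cartan L i k j x y"
  unfolding cartan_def using delta_metric_sym[OF assms, of _ _ j k] by (simp add: add_ac)

text \<open>The vertical part of \<open>delta\<close> contributes nothing, because \<open>y\<close>
  annihilates the Cartan tensor.\<close>

lemma metric_delta_y:
  assumes "(x, y) \<in> W"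
  shows "(\<Sum>j\<in>UNIV. y $ j * delta L k (metric L i j) x y) = 1/2 * pdx k (pdy i (sq L)) x y"
proof -
  have "(\<Sum>j\<in>UNIV. y $ j * delta L k (metric L i j) x y) =
      (\<Sum>j\<in>UNIV. y $ j * pdx k (metric L i j) x y) -
      (\<Sum>j\<in>UNIV. \<Sum>r\<in>UNIV. y $ j * (nonlin_conn L r k x y * pdy r (metric L i j) x y))"
    by (simp add: delta_def right_diff_distrib sum_subtractf sum_distrib_left)
  also have "(\<Sum>j\<in>UNIV. \<Sum>r\<in>UNIV. y $ j * (nonlin_conn L r k x y * pdy r (metric L i j) x y)) =
      (\<Sum>r\<in>UNIV. nonlin_conn L r k x y * (\<Sum>j\<in>UNIV. y $ j * pdy r (metric L i j) x y))"
    by (subst sum.swap) (simp add: sum_distrib_left mult_ac)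
  finally show ?thesis by (simp add: metric_dx_y[OF assms] metric_dy_y[OF assms])
qed

text \<open>The contraction of \<open>delta\<close> with \<open>y\<close> is the derivative along
  the geodesic vector field.\<close>

lemma delta_y:
  assumes "(x, y) \<in> W"
  shows "(\<Sum>j\<in>UNIV. y $ j * delta L j F x y) =
    (\<Sum>j\<in>UNIV. y $ j * pdx j F x y) - (\<Sum>r\<in>UNIV. spray L r x y * pdy r F x y)"
proof -
  have "(\<Sum>j\<in>UNIV. y $ j * delta L j F x y) = (\<Sum>j\<in>UNIV. y $ j * pdx j F x y) -
      (\<Sum>j\<in>UNIV. \<Sum>r\<in>UNIV. y $ j * (nonlin_conn L r j x y * pdy r F x y))"
    by (simp add: delta_def right_diff_distrib sum_subtractf sum_distrib_left)
  also have "(\<Sum>j\<in>UNIV. \<Sum>r\<in>UNIV. y $ j * (nonlin_conn L r j x y * pdy r F x y)) =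
      (\<Sum>r\<in>UNIV. (\<Sum>j\<in>UNIV. y $ j * nonlin_conn L r j x y) * pdy r F x y)"
    by (subst sum.swap) (simp add: sum_distrib_left sum_distrib_right mult_ac)
  finally show ?thesis by (simp add: nonlin_conn_y[OF assms])
qed

text \<open>Contracting \<open>cartan_lower\<close> with \<open>y\<close>, by \<open>delta_y\<close>
  for one term and \<open>metric_delta_y\<close> for the other two, gives half the right-hand side
  of \<open>nonlin_conn_lower\<close>.\<close>

lemma cartan_y:
  assumes "(x, y) \<in> W"
  shows "(\<Sum>j\<in>UNIV. y $ j * cartan L r j k x y) = nonlin_conn L r k x y"
proof (rule metric_cancel[OF assms, of "\<lambda>r. \<Sum>j\<in>UNIV. y $ j * cartan L r j k x y" "\<lambda>r. nonlin_conn L r k x y"])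
  fix i
  let ?g = "\<lambda>i j. metric L i j x y"
  have "2 * (\<Sum>r\<in>UNIV. ?g i r * (\<Sum>j\<in>UNIV. y $ j * cartan L r j k x y)) =
      (\<Sum>j\<in>UNIV. y $ j * (2 * (\<Sum>r\<in>UNIV. ?g i r * cartan L r j k x y)))"
    by (simp add: sum_distrib_left mult_ac) (rule sum.swap)
  also have "\<dots> = (\<Sum>j\<in>UNIV. y $ j * delta L j (metric L i k) x y) +
      (\<Sum>j\<in>UNIV. y $ j * delta L k (metric L i j) x y) - (\<Sum>j\<in>UNIV. y $ j * delta L i (metric L k j) x y)"
    by (simp add: cartan_lower[OF assms] sum.distrib sum_subtractf algebra_simps delta_metric_sym[OF assms, of _ _ _ k])
  also have "\<dots> = 2 * (\<Sum>r\<in>UNIV. ?g i r * nonlin_conn L r k x y)"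
    using nonlin_conn_lower[OF assms, of i k] by (simp add: metric_delta_y[OF assms] delta_y[OF assms])
  finally show "(\<Sum>r\<in>UNIV. ?g i r * (\<Sum>j\<in>UNIV. y $ j * cartan L r j k x y)) =
      (\<Sum>r\<in>UNIV. ?g i r * nonlin_conn L r k x y)" by simp
qed

text \<open>In the sum of two instances of \<open>cartan_lower\<close> all derivatives of the metric
  cancel except those along \<open>k\<close>.\<close>

lemma delta_metric:
  assumes "(x, y) \<in> W"
  shows "delta L k (metric L i j) x y =
    (\<Sum>r\<in>UNIV. metric L j r x y * cartan L r i k x y) + (\<Sum>r\<in>UNIV. metric L i r x y * cartan L r j k x y)"
  using cartan_lower[OF assms, of j i k] cartan_lower[OF assms, of i j k]
    delta_metric_sym[OF assms, of L k i j] delta_metric_sym[OF assms, of L i j k] delta_metric_sym[OF assms, of L j i k]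
    delta_metric_sym[OF assms, of L i k j]
  by linarith

text \<open>The Christoffel argument: for symmetric \<open>C\<close>, the combination of
  compatibility equations in \<open>cartan_lower\<close> leaves only \<open>C\<close>. Since
  \<open>C\<close> is arbitrary, it may come from another metric.\<close>

lemma cartan_unique:
  assumes "(x, y) \<in> W"
    and sym: "\<And>i j k. C i j k = C i k j"
    and compat: "\<And>i j k. delta L k (metric L i j) x y =
      (\<Sum>r\<in>UNIV. metric L j r x y * C r i k) + (\<Sum>r\<in>UNIV. metric L i r x y * C r j k)"
  shows "cartan L i j k x y = C i j k"
proof (rule metric_cancel[OF assms(1), of "\<lambda>r. cartan L r j k x y"])
  fix i
  have "2 * (\<Sum>r\<in>UNIV. metric L i r x y * cartan L r j k x y) =
    2 * (\<Sum>r\<in>UNIV. metric L i r x y * C r j k)"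
    unfolding cartan_lower[OF assms(1)] compat
    by (simp add: sym[of _ k j] sym[of _ j i] sym[of _ k i])
  then show "(\<Sum>r\<in>UNIV. metric L i r x y * cartan L r j k x y) = (\<Sum>r\<in>UNIV. metric L i r x y * C r j k)"
    by simp
qed

text \<open>Apply \<open>delta\<close> to \<open>metric_y\<close>. Of the two sums from metric
  compatibility, one contracts to the nonlinear connection by \<open>cartan_y\<close> and cancels
  against the derivative of \<open>y $ j\<close>.\<close>

lemma delta_pdy_sq:
  assumes "(x, y) \<in> W"
  shows "delta L k (pdy i (sq L)) x y = (\<Sum>r\<in>UNIV. cartan L r i k x y * pdy r (sq L) x y)"
proof -
  let ?g = "\<lambda>i j. metric L i j x y" and ?C = "\<lambda>i j k. cartan L i j k x y"
  have eq: "pdy i (sq L) x y = 2 * (\<Sum>j\<in>UNIV. y $ j * metric L i j x y)" if "(x, y) \<in> W" for x y i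
    using metric_y[OF that, of i] by simp
  have "delta L k (pdy i (sq L)) x y = delta L k (\<lambda>x y. 2 * (\<Sum>j\<in>UNIV. y $ j * metric L i j x y)) x y"
    by (rule delta_transform[OF open_W assms _ eq]) (intro diff2_intros diff2_metric assms)
  also have "\<dots> = 2 * ((\<Sum>j\<in>UNIV. y $ j * delta L k (metric L i j) x y) - (\<Sum>j\<in>UNIV. ?g i j * nonlin_conn L j k x y))"
    using assms by (simp add: delta_rules diff2_intros diff2_metric sum_subtractf right_diff_distrib mult_ac)
  also have "(\<Sum>j\<in>UNIV. y $ j * delta L k (metric L i j) x y) =
      (\<Sum>j\<in>UNIV. \<Sum>r\<in>UNIV. y $ j * (?g j r * ?C r i k)) + (\<Sum>j\<in>UNIV. \<Sum>r\<in>UNIV. y $ j * (?g i r * ?C r j k))"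
    by (simp add: delta_metric[OF assms] sum_distrib_left sum.distrib distrib_left)
  also have "(\<Sum>j\<in>UNIV. \<Sum>r\<in>UNIV. y $ j * (?g j r * ?C r i k)) = (\<Sum>r\<in>UNIV. ?C r i k * (\<Sum>j\<in>UNIV. y $ j * ?g r j))"
    by (subst sum.swap) (simp add: sum_distrib_left mult_ac metric_sym[OF assms, of r for r])
  also have "(\<Sum>j\<in>UNIV. \<Sum>r\<in>UNIV. y $ j * (?g i r * ?C r j k)) = (\<Sum>r\<in>UNIV. ?g i r * (\<Sum>j\<in>UNIV. y $ j * ?C r j k))"
    by (subst sum.swap) (simp add: sum_distrib_left mult_ac)
  finally show ?thesis
    by (simp add: cartan_y[OF assms] metric_y[OF assms] sum_distrib_left)
qed

text \<open>Apply \<open>delta\<close> to the Euler relation; the connection terms contract to the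
  nonlinear connection, which the derivative of \<open>y $ i\<close> cancels.\<close>

lemma delta_sq:
  assumes "(x, y) \<in> W"
  shows "delta L k (sq L) x y = 0"
proof -
  have "delta L k (\<lambda>x y. \<Sum>i\<in>UNIV. y $ i * pdy i (sq L) x y) x y = delta L k (\<lambda>x y. 2 * sq L x y) x y"
    by (rule delta_transform[OF open_W assms]) (auto intro!: diff2_intros diff2_L assms euler_sq)
  then have "2 * delta L k (sq L) x y =
      (\<Sum>i\<in>UNIV. \<Sum>r\<in>UNIV. y $ i * (cartan L r i k x y * pdy r (sq L) x y)) -
      (\<Sum>i\<in>UNIV. nonlin_conn L i k x y * pdy i (sq L) x y)"
    using assms
    by (simp add: delta_rules diff2_intros diff2_L delta_pdy_sq sum_subtractf sum_distrib_left)
  also have "(\<Sum>i\<in>UNIV. \<Sum>r\<in>UNIV. y $ i * (cartan L r i k x y * pdy r (sq L) x y)) =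
      (\<Sum>r\<in>UNIV. (\<Sum>i\<in>UNIV. y $ i * cartan L r i k x y) * pdy r (sq L) x y)"
    by (subst sum.swap) (simp add: sum_distrib_left sum_distrib_right mult_ac)
  finally show ?thesis by (simp add: cartan_y[OF assms])
qed

lemma delta_self:
  assumes "(x, y) \<in> W"
  shows "delta L k L x y = 0"
proof -
  have "2 * L x y * delta L k L x y = 0"
    using delta_sq[OF assms, of k] assms by (simp add: sq_def power2_eq_square delta_mult diff2_L)
  then show ?thesis using L_pos[of x y] assms by auto
qed

lemma delta_pdy:
  assumes "(x, y) \<in> W"
  shows "delta L k (pdy i L) x y = (\<Sum>r\<in>UNIV. cartan L r i k x y * pdy r L x y)"
proof -
  have "delta L k (pdy i (sq L)) x y = delta L k (\<lambda>x y. 2 * L x y * pdy i L x y) x y"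
    by (rule delta_transform[OF open_W assms]) (auto intro!: diff2_intros diff2_L assms pdy_sq)
  also have "\<dots> = 2 * L x y * delta L k (pdy i L) x y"
    using assms by (simp add: delta_rules diff2_intros diff2_L delta_self)
  finally have "2 * L x y * delta L k (pdy i L) x y = 2 * L x y * (\<Sum>r\<in>UNIV. cartan L r i k x y * pdy r L x y)"
    unfolding delta_pdy_sq[OF assms] by (simp add: pdy_sq[OF assms] sum_distrib_left mult_ac)
  then show ?thesis using L_pos[of x y] assms by auto
qed

text \<open>Isolates the Hessian of \<open>L\<close> in \<open>y\<close>, which under the change is
  merely multiplied by the conformal factor.\<close>

lemma metric_eq:
  assumes "(x, y) \<in> W"
  shows "metric L i j x y = pdy i L x y * pdy j L x y + L x y * pdy i (pdy j L) x y"
proof -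
  have "pdy i (pdy j (sq L)) x y = pdy i (\<lambda>x y. 2 * L x y * pdy j L x y) x y"
    by (rule pdy_transform[OF open_W assms]) (auto intro!: diff2_intros diff2_L assms pdy_sq)
  also have "\<dots> = 2 * (pdy i L x y * pdy j L x y + L x y * pdy i (pdy j L) x y)"
    using assms by (simp add: pdy_rules diff2_intros diff2_L)
  finally show ?thesis by (simp add: metric_def)
qed

text \<open>Apply \<open>delta\<close> to \<open>metric_eq\<close>: \<open>L\<close> is horizontally
  constant, and \<open>delta_pdy\<close> accounts for the product of first derivatives. What remains
  of metric compatibility is the claim times \<open>L x y\<close>.\<close>

lemma delta_pdy_pdy:
  assumes "(x, y) \<in> W"
  shows "delta L k (pdy i (pdy j L)) x y =
    (\<Sum>r\<in>UNIV. pdy j (pdy r L) x y * cartan L r i k x y) + (\<Sum>r\<in>UNIV. pdy i (pdy r L) x y * cartan L r j k x y)"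
    (is "_ = ?R")
proof -
  let ?C = "\<lambda>i j k. cartan L i j k x y" and ?l = "\<lambda>i. pdy i L x y"
  have "delta L k (metric L i j) x y =
      delta L k (\<lambda>x y. pdy i L x y * pdy j L x y + L x y * pdy i (pdy j L) x y) x y"
    by (rule delta_transform[OF open_W assms]) (auto intro!: diff2_intros diff2_L assms metric_eq)
  also have "\<dots> = ?l i * (\<Sum>r\<in>UNIV. ?C r j k * ?l r) + (\<Sum>r\<in>UNIV. ?C r i k * ?l r) * ?l j
      + L x y * delta L k (pdy i (pdy j L)) x y"
    using assms by (simp add: delta_rules diff2_intros diff2_L delta_self delta_pdy)
  finally have "delta L k (metric L i j) x y = \<dots>" .
  moreover have "delta L k (metric L i j) x y =
      ?l i * (\<Sum>r\<in>UNIV. ?C r j k * ?l r) + (\<Sum>r\<in>UNIV. ?C r i k * ?l r) * ?l j + L x y * ?R"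
    unfolding delta_metric[OF assms] metric_eq[OF assms]
    by (simp add: sum.distrib distrib_right sum_distrib_left sum_distrib_right distrib_left mult_ac)
  ultimately have "L x y * delta L k (pdy i (pdy j L)) x y = L x y * ?R" by linarith
  then show ?thesis using L_pos[of x y] assms by auto
qed

end

section \<open>\<open>\<beta>\<close>-conformal changes\<close>

lemma delta_fst:
  "f differentiable (at x) \<Longrightarrow> delta L k (\<lambda>x y. f x) x y = frechet_derivative f (at x) (axis k 1)"
  by (simp add: delta_eq_dir2 diff2_fst dir2_fst)

lemma pdy_fst: "f differentiable (at x) \<Longrightarrow> pdy k (\<lambda>x y. f x) x y = 0"
  by (simp add: pdy_eq_dir2 diff2_fst dir2_fst linear_0 linear_frechet_derivative)

text \<open>The change in one chart: \<open>s\<close> and \<open>b\<close> are the local expressions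
  of \<open>\<sigma>\<close> and of the coefficients of \<open>\<beta>\<close>.\<close>

locale beta_change = M: finsler_chart V L + M': finsler_chart V L'
  for V :: "(real ^ 'n) set" and L L' :: "real ^ 'n \<Rightarrow> real ^ 'n \<Rightarrow> real" +
  fixes s :: "real ^ 'n \<Rightarrow> real" and b :: "real ^ 'n \<Rightarrow> real ^ 'n"
  assumes s_differentiable: "x \<in> V \<Longrightarrow> s differentiable (at x)"
    and b_differentiable: "x \<in> V \<Longrightarrow> b differentiable (at x)"
    and L'_eq: "x \<in> V \<Longrightarrow> L' x y = exp (s x) * L x y + (\<Sum>i\<in>UNIV. b x $ i * y $ i)"
begin

abbreviation W where "W \<equiv> V \<times> (- {0 :: real ^ 'n})"

abbreviation ds where "ds k x \<equiv> frechet_derivative s (at x) (axis k 1)"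

lemma differentiable_b_nth: "x \<in> V \<Longrightarrow> (\<lambda>x. b x $ i) differentiable (at x)"
  using b_differentiable differentiable_compose[of "\<lambda>v. v $ i" b x UNIV]
  by (simp add: bounded_linear_imp_differentiable bounded_linear_vec_nth)

lemma exp_s_has_derivative:
  "x \<in> V \<Longrightarrow> ((\<lambda>x. exp (s x)) has_derivative (\<lambda>v. exp (s x) * frechet_derivative s (at x) v)) (at x)"
  using s_differentiable[of x]
  by (auto intro!: derivative_eq_intros simp: frechet_derivative_works)

lemma differentiable_exp_s: "x \<in> V \<Longrightarrow> (\<lambda>x. exp (s x)) differentiable (at x)"
  using exp_s_has_derivative differentiable_def by blast

lemma delta_exp_s: "x \<in> V \<Longrightarrow> delta F k (\<lambda>x y. exp (s x)) x y = exp (s x) * ds k x"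
  by (simp add: delta_fst differentiable_exp_s flip: frechet_derivative_at[OF exp_s_has_derivative])

lemma diff2_b: "(x, y) \<in> W \<Longrightarrow> diff2 (\<lambda>x y. b x $ i) x y"
  and diff2_exp_s: "(x, y) \<in> W \<Longrightarrow> diff2 (\<lambda>x y. exp (s x)) x y"
  by (auto intro!: diff2_fst differentiable_b_nth differentiable_exp_s)

lemma pdy_exp_s: "(x, y) \<in> W \<Longrightarrow> pdy k (\<lambda>x y. exp (s x)) x y = 0"
  and pdy_b: "(x, y) \<in> W \<Longrightarrow> pdy k (\<lambda>x y. b x $ i) x y = 0"
  by (auto simp: pdy_fst differentiable_b_nth differentiable_exp_s)

lemmas diff2_rules = diff2_intros diff2_b diff2_exp_s M.diff2_L M'.diff2_L

lemma pdy_L':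
  assumes "(x, y) \<in> W"
  shows "pdy i L' x y = exp (s x) * pdy i L x y + b x $ i"
proof -
  have "pdy i L' x y = pdy i (\<lambda>x y. exp (s x) * L x y + (\<Sum>i\<in>UNIV. b x $ i * y $ i)) x y"
    by (rule pdy_transform[OF M.open_W assms]) (auto intro!: diff2_rules assms L'_eq)
  then show ?thesis
    using assms by (simp add: pdy_rules diff2_rules pdy_exp_s pdy_b sum_axis)
qed

lemma pdy_pdy_L':
  assumes "(x, y) \<in> W"
  shows "pdy i (pdy j L') x y = exp (s x) * pdy i (pdy j L) x y"
proof -
  have "pdy i (pdy j L') x y = pdy i (\<lambda>x y. exp (s x) * pdy j L x y + b x $ j) x y"
    by (rule pdy_transform[OF M.open_W assms]) (auto intro!: diff2_rules assms pdy_L')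
  then show ?thesis
    using assms by (simp add: pdy_rules diff2_rules pdy_exp_s pdy_b)
qed

text \<open>The definition of \<open>hcov\<close> trades the derivative of \<open>b\<close> for a
  connection term, which combines with that of \<open>delta_pdy\<close> into one for
  \<open>L'\<close>. The remaining two terms measure how far the connection of \<open>L\<close> is
  from satisfying \<open>delta_pdy\<close> for \<open>L'\<close>.\<close>

lemma delta_pdy_L':
  assumes "(x, y) \<in> W"
  shows "delta L k (pdy i L') x y = exp (s x) * ds k x * pdy i L x y + hcov L b i k x y +
    (\<Sum>r\<in>UNIV. cartan L r i k x y * pdy r L' x y)"
proof -
  have "delta L k (pdy i L') x y = delta L k (\<lambda>x y. exp (s x) * pdy i L x y + b x $ i) x y"
    by (rule delta_transform[OF M.open_W assms]) (auto intro!: diff2_rules assms pdy_L')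
  also have "\<dots> = exp (s x) * (\<Sum>r\<in>UNIV. cartan L r i k x y * pdy r L x y) + exp (s x) * ds k x * pdy i L x y
      + delta L k (\<lambda>x y. b x $ i) x y"
    using assms by (simp add: delta_rules diff2_rules delta_exp_s M.delta_pdy)
  finally show ?thesis
    by (simp add: hcov_def pdy_L'[OF assms] distrib_left sum.distrib sum_distrib_left mult_ac)
qed

text \<open>Equality at the one point suffices: contraction with \<open>y\<close> gives equal
  nonlinear connections there, hence equal operators \<open>delta\<close>, and
  \<open>delta_pdy\<close> for \<open>L'\<close> can be compared with
  \<open>delta_pdy_L'\<close>.\<close>

lemma hcov_of_cartan_eq:
  assumes "(x, y) \<in> W" and C: "\<And>i j k. cartan L' i j k x y = cartan L i j k x y"
  shows "exp (s x) * ds k x * pdy i L x y + hcov L b i k x y = 0"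
proof -
  have "nonlin_conn L' r k x y = nonlin_conn L r k x y" for r k
    using M.cartan_y[OF assms(1), of r k] M'.cartan_y[OF assms(1), of r k] by (simp add: C)
  then have "delta L' k (pdy i L') x y = delta L k (pdy i L') x y"
    by (simp add: delta_def)
  then show ?thesis
    using M'.delta_pdy[OF assms(1), of k i] delta_pdy_L'[OF assms(1), of k i] by (simp add: C)
qed

text \<open>Contracting \<open>hcov_of_cartan_eq\<close> with \<open>y\<close> leaves
  \<open>ds k x * L x y = 0\<close> by Euler's relation, and \<open>L\<close> is positive.\<close>

lemma ds_eq_0:
  assumes "(x, y) \<in> W" "\<And>i j k. cartan L' i j k x y = cartan L i j k x y"
    and "\<And>i. hcov L b i k x y = 0"
  shows "ds k x = 0"
proof -
  have "ds k x * pdy i L x y = 0" for i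
    using hcov_of_cartan_eq[OF assms(1,2), of k i] assms(3)[of i] by simp
  then have "(\<Sum>i\<in>UNIV. y $ i * (ds k x * pdy i L x y)) = 0"
    by (simp only: mult_zero_right sum.neutral_const)
  then have "ds k x * (\<Sum>i\<in>UNIV. y $ i * pdy i L x y) = 0"
    by (simp add: sum_distrib_left mult_ac)
  then show ?thesis using M.euler_L[OF assms(1)] M.L_pos[of x y] assms(1) by auto
qed

section \<open>Equality of the connections for homothetic \<open>\<sigma>\<close> and parallel
  \<open>b\<close>\<close>

context
  assumes homothetic: "\<And>x k. x \<in> V \<Longrightarrow> ds k x = 0"
    and parallel: "\<And>x y i k. (x, y) \<in> W \<Longrightarrow> hcov L b i k x y = 0"
begin

text \<open>Parallelism turns the derivative of \<open>b\<close> into a connection term; contracted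
  with \<open>y\<close> it becomes the nonlinear connection and cancels against the derivative of
  \<open>y $ i\<close>.\<close>

lemma delta_L'_eq_0:
  assumes "(x, y) \<in> W"
  shows "delta L k L' x y = 0"
proof -
  have "delta L k L' x y = delta L k (\<lambda>x y. exp (s x) * L x y + (\<Sum>i\<in>UNIV. b x $ i * y $ i)) x y"
    by (rule delta_transform[OF M.open_W assms]) (auto intro!: diff2_rules assms L'_eq)
  also have "\<dots> = (\<Sum>i\<in>UNIV. delta L k (\<lambda>x y. b x $ i) x y * y $ i) - (\<Sum>i\<in>UNIV. b x $ i * nonlin_conn L i k x y)"
    using assms by (simp add: delta_rules diff2_rules delta_exp_s M.delta_self homothetic sum_subtractf)
  also have "(\<Sum>i\<in>UNIV. delta L k (\<lambda>x y. b x $ i) x y * y $ i) =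
      (\<Sum>i\<in>UNIV. \<Sum>r\<in>UNIV. b x $ r * cartan L r i k x y * y $ i)"
    using parallel[OF assms] by (simp add: hcov_def sum_distrib_right)
  also have "\<dots> = (\<Sum>r\<in>UNIV. b x $ r * (\<Sum>i\<in>UNIV. y $ i * cartan L r i k x y))"
    by (subst sum.swap) (simp add: sum_distrib_left mult_ac)
  finally show ?thesis by (simp add: M.cartan_y[OF assms])
qed

lemma delta_pdy_L'_parallel:
  "(x, y) \<in> W \<Longrightarrow> delta L k (pdy i L') x y = (\<Sum>r\<in>UNIV. cartan L r i k x y * pdy r L' x y)"
  by (simp add: delta_pdy_L' homothetic parallel)

lemma spray_eq:
  assumes "(x, y) \<in> W"
  shows "spray L' r x y = spray L r x y"
proof (rule M'.spray_unique[OF assms])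
  fix i
  have "delta L k (sq L') x y = 0" for k
    using assms by (simp add: sq_def power2_eq_square delta_rules diff2_rules delta_L'_eq_0)
  \<comment> \<open>Horizontal constancy of L'^2 expresses its derivatives in position by those in
    direction.\<close>
  then have dx: "pdx i (sq L') x y = (\<Sum>r\<in>UNIV. nonlin_conn L r i x y * pdy r (sq L') x y)"
    by (simp add: delta_def)
  have "delta L k (pdy i (sq L')) x y = (\<Sum>r\<in>UNIV. cartan L r i k x y * pdy r (sq L') x y)" for k
  proof -
    have "delta L k (pdy i (sq L')) x y = delta L k (\<lambda>x y. 2 * L' x y * pdy i L' x y) x y"
      by (rule delta_transform[OF M.open_W assms]) (auto intro!: diff2_rules assms M'.pdy_sq)
    then show ?thesis
      using assms
      by (simp add: delta_rules diff2_rules delta_L'_eq_0 delta_pdy_L'_parallel M'.pdy_sq sum_distrib_left mult_ac)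
  qed
  then have "(\<Sum>k\<in>UNIV. y $ k * delta L k (pdy i (sq L')) x y) =
      (\<Sum>k\<in>UNIV. \<Sum>r\<in>UNIV. y $ k * (cartan L r i k x y * pdy r (sq L') x y))"
    by (simp add: sum_distrib_left)
  \<comment> \<open>Symmetry brings the contracted index into the first lower slot, as
    \<open>cartan_y\<close> requires.\<close>
  also have "\<dots> = (\<Sum>r\<in>UNIV. (\<Sum>k\<in>UNIV. y $ k * cartan L r k i x y) * pdy r (sq L') x y)"
    by (subst sum.swap) (simp add: sum_distrib_left sum_distrib_right mult_ac M.cartan_sym[OF assms, of _ i])
  also have "\<dots> = pdx i (sq L') x y"
    by (simp add: M.cartan_y[OF assms] dx)
  finally have "(\<Sum>k\<in>UNIV. y $ k * pdx k (pdy i (sq L')) x y) - pdx i (sq L') x y =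
      (\<Sum>r\<in>UNIV. spray L r x y * pdy r (pdy i (sq L')) x y)"
    by (simp add: M.delta_y[OF assms])
  also have "\<dots> = (\<Sum>r\<in>UNIV. spray L r x y * (2 * metric L' r i x y))"
    by (simp add: metric_def)
  also have "\<dots> = 2 * (\<Sum>r\<in>UNIV. metric L' i r x y * spray L r x y)"
    by (simp add: sum_distrib_left mult_ac M'.metric_sym[OF assms, of _ i])
  finally show "2 * (\<Sum>r\<in>UNIV. metric L' i r x y * spray L r x y) =
      (\<Sum>k\<in>UNIV. y $ k * pdx k (pdy i (sq L')) x y) - pdx i (sq L') x y" by simp
qed

text \<open>The sprays agree on the whole open set \<open>W\<close>, so their derivatives in
  \<open>y\<close> agree as well.\<close>

lemma nonlin_conn_eq:
  assumes "(x, y) \<in> W"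
  shows "nonlin_conn L' i j x y = nonlin_conn L i j x y"
  unfolding nonlin_conn_def
  using pdy_transform[OF M.open_W assms M.diff2_spray[OF assms] spray_eq] by simp

text \<open>The conformal factor has zero derivative, so the Hessian of \<open>L'\<close> inherits
  \<open>delta_pdy_pdy\<close> from \<open>L\<close>; the product rule on \<open>metric_eq\<close>
  for \<open>L'\<close> then assembles the two connection sums.\<close>

lemma delta_metric_L':
  assumes "(x, y) \<in> W"
  shows "delta L k (metric L' i j) x y =
    (\<Sum>r\<in>UNIV. metric L' j r x y * cartan L r i k x y) + (\<Sum>r\<in>UNIV. metric L' i r x y * cartan L r j k x y)"
proof -
  let ?C = "\<lambda>i j k. cartan L i j k x y" and ?l = "\<lambda>i. pdy i L' x y" and ?h = "\<lambda>i j. pdy i (pdy j L') x y"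
  have "delta L k (pdy i (pdy j L')) x y = delta L k (\<lambda>x y. exp (s x) * pdy i (pdy j L) x y) x y"
    by (rule delta_transform[OF M.open_W assms]) (auto intro!: diff2_rules assms pdy_pdy_L')
  also have "\<dots> = (\<Sum>r\<in>UNIV. ?h j r * ?C r i k) + (\<Sum>r\<in>UNIV. ?h i r * ?C r j k)"
    using assms
    by (simp add: delta_rules diff2_rules delta_exp_s homothetic M.delta_pdy_pdy pdy_pdy_L'
        sum_distrib_left distrib_left mult_ac)
  finally have h: "delta L k (pdy i (pdy j L')) x y = \<dots>" .
  have "delta L k (metric L' i j) x y =
      delta L k (\<lambda>x y. pdy i L' x y * pdy j L' x y + L' x y * pdy i (pdy j L') x y) x y"
    by (rule delta_transform[OF M.open_W assms]) (auto intro!: diff2_rules assms M'.metric_eq)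
  also have "\<dots> = ?l i * (\<Sum>r\<in>UNIV. ?C r j k * ?l r) + (\<Sum>r\<in>UNIV. ?C r i k * ?l r) * ?l j
      + L' x y * ((\<Sum>r\<in>UNIV. ?h j r * ?C r i k) + (\<Sum>r\<in>UNIV. ?h i r * ?C r j k))"
    using assms by (simp add: delta_rules diff2_rules delta_L'_eq_0 delta_pdy_L'_parallel h)
  finally show ?thesis
    unfolding M'.metric_eq[OF assms]
    by (simp add: sum.distrib distrib_right sum_distrib_left sum_distrib_right distrib_left mult_ac)
qed

lemma cartan_eq:
  assumes "(x, y) \<in> W"
  shows "cartan L' i j k x y = cartan L i j k x y"
proof (rule M'.cartan_unique[OF assms, of "\<lambda>i j k. cartan L i j k x y"])
  show "cartan L i j k x y = cartan L i k j x y" for i j k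
    by (rule M.cartan_sym[OF assms])
  show "delta L' k (metric L' i j) x y =
    (\<Sum>r\<in>UNIV. metric L' j r x y * cartan L r i k x y) + (\<Sum>r\<in>UNIV. metric L' i r x y * cartan L r j k x y)" for i j k
    using delta_metric_L'[OF assms, of k i j] by (simp add: delta_def nonlin_conn_eq[OF assms])
qed

end

end

section \<open>Passage from charts to the manifold\<close>

lemma finsler_metric_chart:
  assumes "smooth_atlas A" "finsler_metric A F" "c \<in> A"
  shows "finsler_chart (chart_image c) (in_coords A c F)"
proof
  show "open (chart_image c)"
    using assms(1,3) by (auto simp: smooth_atlas_def chart_image_def split: prod.splits)
qed (use assms(2,3) in \<open>auto simp: finsler_metric_def Let_def\<close>)

theorem theoremB:
  fixes A :: "('m::{t2_space, second_countable_topology}, 'n::finite) chart set"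
    and L \<beta> :: "'m \<Rightarrow> 'm tangent \<Rightarrow> real"
    and \<sigma> :: "'m \<Rightarrow> real"
  assumes "smooth_atlas A"
    and "finsler_metric A L"
    and "smooth_fun_on A UNIV \<sigma>"
    and "one_form A \<beta>"
    and "finsler_metric A (beta_conformal \<sigma> \<beta> L)"
  shows "(cartan_parallel A L \<beta> \<and> difference_vanishes A L (beta_conformal \<sigma> \<beta> L) \<longrightarrow> homothetic A \<sigma>) \<and>
    (homothetic A \<sigma> \<longrightarrow>
      (cartan_parallel A L \<beta> \<longleftrightarrow> difference_vanishes A L (beta_conformal \<sigma> \<beta> L)))"
proof -
  let ?L = "\<lambda>c. in_coords A c L" and ?L' = "\<lambda>c. in_coords A c (beta_conformal \<sigma> \<beta> L)"
    and ?b = "one_form_coeff A" and ?s = "\<lambda>c. \<sigma> \<circ> chart_inv c"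
  have chart: "beta_change (chart_image c) (?L c) (?L' c) (?s c) (?b c \<beta>)" if c: "c \<in> A" for c
  proof -
    interpret M: finsler_chart "chart_image c" "?L c"
      using finsler_metric_chart assms(1,2) c .
    interpret M': finsler_chart "chart_image c" "?L' c"
      using finsler_metric_chart assms(1,5) c .
    have s: "smooth_on (chart_image c) (?s c)"
      using assms(3) c by (simp add: smooth_fun_on_def chart_image_def)
    have b: "smooth_on (chart_image c) (?b c \<beta>)"
      and eq: "\<And>x y. x \<in> chart_image c \<Longrightarrow> in_coords A c \<beta> x y = (\<Sum>i\<in>UNIV. ?b c \<beta> x $ i * y $ i)"
      using assms(4) c by (auto simp: one_form_def)
    show ?thesis
    proof
      \<comment> \<open>Both metrics and the form are evaluated at the same tangent vector, so the
        change holds pointwise in coordinates.\<close>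
      show "?L' c x y = exp (?s c x) * ?L c x y + (\<Sum>i\<in>UNIV. ?b c \<beta> x $ i * y $ i)"
        if "x \<in> chart_image c" for x y
        using eq[OF that, of y] by (simp add: in_coords_def beta_conformal_def)
    qed (use s b smooth_on_imp_differentiable in blast)+
  qed
  have a: "homothetic A \<sigma>"
    if "cartan_parallel A L \<beta>" "difference_vanishes A L (beta_conformal \<sigma> \<beta> L)"
    unfolding homothetic_def
  proof (intro ballI allI)
    fix c x k assume c: "c \<in> A" and x: "x \<in> chart_image c"
    interpret beta_change "chart_image c" "?L c" "?L' c" "?s c" "?b c \<beta>"
      using chart[OF c] .
    \<comment> \<open>Any nonzero direction serves in \<open>ds_eq_0\<close>; a basis vector is at
      hand in every dimension.\<close>
    have y: "axis k 1 \<noteq> (0 :: real ^ 'n)" by (simp add: axis_eq_0_iff)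
    show "frechet_derivative (?s c) (at x) (axis k 1) = 0"
      using that c x y
      by (intro ds_eq_0[of x "axis k 1"])
        (auto simp: cartan_parallel_def difference_vanishes_def difference_tensor_def)
  qed
  have b1: "difference_vanishes A L (beta_conformal \<sigma> \<beta> L)"
    if "homothetic A \<sigma>" "cartan_parallel A L \<beta>"
    unfolding difference_vanishes_def difference_tensor_def
  proof (intro ballI allI impI)
    fix c x y i j k assume c: "c \<in> A" and x: "x \<in> chart_image c" and y: "(y :: real ^ 'n) \<noteq> 0"
    interpret beta_change "chart_image c" "?L c" "?L' c" "?s c" "?b c \<beta>"
      using chart[OF c] .
    \<comment> \<open>\<open>cartan_eq\<close> uses both hypotheses on the whole chart image, since
      its proof differentiates the equality of the sprays.\<close>
    have "cartan (?L' c) i j k x y = cartan (?L c) i j k x y"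
      using that c x y by (intro cartan_eq) (auto simp: homothetic_def cartan_parallel_def)
    then show "cartan (?L' c) i j k x y - cartan (?L c) i j k x y = 0" by simp
  qed
  have b2: "cartan_parallel A L \<beta>"
    if "homothetic A \<sigma>" "difference_vanishes A L (beta_conformal \<sigma> \<beta> L)"
    unfolding cartan_parallel_def
  proof (intro ballI allI impI)
    fix c x y i k assume c: "c \<in> A" and x: "x \<in> chart_image c" and y: "(y :: real ^ 'n) \<noteq> 0"
    interpret beta_change "chart_image c" "?L c" "?L' c" "?s c" "?b c \<beta>"
      using chart[OF c] .
    have "exp (?s c x) * ds k x * pdy i (?L c) x y + hcov (?L c) (?b c \<beta>) i k x y = 0"
      using that(2) c x y
      by (intro hcov_of_cartan_eq) (auto simp: difference_vanishes_def difference_tensor_def)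
    then show "hcov (?L c) (?b c \<beta>) i k x y = 0"
      using that(1) c x by (simp add: homothetic_def)
  qed
  from a b1 b2 show ?thesis by blast
qed

end
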